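(* Let $N\ge 1$ and $k,j,\ell\ge 0$ be integers. The number of partitions of $N$ into parts congruent to $2$ or $3$ modulo $5$ with exactly $k$ $2$'s, $j$ $3$'s and $\ell$ $7$'s is equal to the number of partitions $\lambda\in\mathsf{Diff_2}^*$ of $N$ such that: (1) if $\lambda$ has at least seven parts, then $col^*(\lambda)$ has exactly $k$ $2$'s, $j$ $3$'s and $\ell$ $7$'s; (2) if $\lambda$ has four, five or six parts, then $col^*(\lambda)$ has exactly $k$ $2$'s, $j$ $3$'s and between $7\ell$ and $7\ell+6$ (inclusive) $1$'s; (3) if $\lambda$ has three parts, then $col^*(\lambda)$ has exactly $k$ $2$'s, $j$ $3$'s, and the number of its $1$'s is one of $7\ell$, $7\ell+1$, $7\ell-12$, $7\ell-4$, $7\ell+4$, $7\ell+5$, $7\ell+6$; (4) if $\lambda$ has two parts, then either (a) $\ell=0$ and $col^*(\lambda)=2^{k}1^{3(j-2)}$ or $col^*(\lambda)=2^k1^{3j+2}$, or (b) $\ell=1$ and $col^*(\lambda)=2^{k}1^{3j+1}$; (5) if $\lambda$ has one part, then either (a) $col^*(\lambda)=1^{2k-2}$, $k\ge 1$, and $j=\ell=0$, or (b) $col^*(\lambda)=1^{2k+1}$, $k\ge 0$, $j=1$ and $\ell=0$.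
   Context: Partitions are written with weakly decreasing positive parts; $2^{a}1^{b}$ denotes the partition with $a$ parts equal to $2$ and $b$ parts equal to $1$ (only possible when $a,b\ge 0$). $\mathsf{Diff_2}$ is the set of partitions $\lambda=(\lambda_1,\dots,\lambda_m)$ whose consecutive differences are at least two, i.e. $\lambda_i-\lambda_{i+1}\ge 2$ for $1\le i<m$. $\mathsf{Diff_2}^*$ is the subset of those partitions in $\mathsf{Diff_2}$ with no part equal to $1$. For $\lambda=(\lambda_1,\dots,\lambda_m)\in\mathsf{Diff_2}^*$, $col^*(\lambda)$ is the partition formed by the columns of (i.e. the conjugate of) $(\lambda_1-2m,\lambda_2-2(m-1),\dots,\lambda_m-2)$, where zero entries are ignored. Example: $col^*((13,10,6,4))=(5,4,2,2)^T=(4,4,2,2,1)$. *)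

theory Defs
  imports Main
begin

definition is_partition :: "nat list \<Rightarrow> bool" where
  "is_partition xs \<longleftrightarrow> sorted_wrt (\<ge>) xs \<and> (\<forall>x\<in>set xs. 0 < x)"

definition partitions_of :: "nat \<Rightarrow> nat list set" where
  "partitions_of N = {xs. is_partition xs \<and> sum_list xs = N}"

(* 2^a 1^b *)
definition twos_ones :: "nat \<Rightarrow> nat \<Rightarrow> nat list" where
  "twos_ones a b = replicate a 2 @ replicate b 1"

definition Diff2 :: "nat list set" where
  "Diff2 = {xs. is_partition xs \<and> (\<forall>i. Suc i < length xs \<longrightarrow> xs ! i \<ge> xs ! Suc i + 2)}"

definition Diff2_star :: "nat list set" where
  "Diff2_star = {xs \<in> Diff2. 1 \<notin> set xs}"

(* The c-th part of the conjugate is the number of parts that are at least c;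
   0 is inserted only to make Max meaningful for the empty partition. *)
definition conjugate :: "nat list \<Rightarrow> nat list" where
  "conjugate xs = map (\<lambda>c. length (filter (\<lambda>x. c \<le> x) xs)) [1..<Suc (Max (insert 0 (set xs)))]"

(* Indices start at 0, so the entry of index i has 2 * (m - i) subtracted, m being the number of
   parts. On Diff2_star that entry is at least 2 * (m - i), so no subtraction is truncated. *)
definition col_star :: "nat list \<Rightarrow> nat list" where
  "col_star xs = conjugate (filter (\<lambda>x. 0 < x)
     (map (\<lambda>i. xs ! i - 2 * (length xs - i)) [0..<length xs]))"

lemma "col_star [13, 10, 6, 4] = [4, 4, 2, 2, 1]"
  by code_simp

lemma finite_partitions_of: "finite (partitions_of N)"
proof (rule finite_subset)
  have len: "length xs \<le> sum_list xs" if "\<forall>x\<in>set xs. 0 < x" for xs :: "nat list"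
    using that by (induction xs) auto
  show "partitions_of N \<subseteq> {xs. set xs \<subseteq> {..N} \<and> length xs \<le> N}"
    using len by (auto simp: partitions_of_def is_partition_def member_le_sum_list)
  show "finite {xs. set xs \<subseteq> {..N} \<and> length xs \<le> N}"
    by (rule finite_lists_length_le) simp
qed

end

(* A partition in Diff_2^* with m parts is determined by m and col^*, an arbitrary partition into
   parts at most m, and its size is m(m+1) + |col^*|. Put q = X and W = (1-q^2)(1-q^3)(1-q^7).
   Prescribing the numbers of 2's, 3's and 7's of a partition multiplies its generating function by
   q^T W, where T = 2k+3j+7l; if m is 4, 5 or 6 the interval of allowed numbers of 1's has the same
   effect as fixing the number of 7's. The cases m = 1, 2, 3 are chosen so that together they
   contribute q^T (1 + q^8 + q^12 + q^13 + q^16 + q^17 + q^18), up to the empty partition, and this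
   is q^T W times the sum of q^(m(m+1))/(q)_m over m = 0, ..., 3. So the theorem is q^T W times the
   second Rogers-Ramanujan identity.

   That identity is proved as in Bressoud's "An easy proof of the Rogers-Ramanujan identities": two
   Bailey steps, which are instances of the q-Chu-Vandermonde sum, applied to the unit Bailey pair
   give a finite identity, and letting its size grow leaves a theta series that the Jacobi triple
   product evaluates. Limits are replaced by congruences modulo X^M. *)

theory Submission
  imports Defs "HOL-Computational_Algebra.Formal_Power_Series" "HOL-Library.Multiset"
begin

section \<open>q-binomial coefficients and the finite Jacobi triple product\<close>

text \<open>For m = 0, 1, 2 the series q^(m(m+1)) W/(q)_m has negative coefficients and counts
  nothing by itself; only the sum over m = 0, ..., 3 has nonnegative ones. This is the origin of the
  irregular conditions for few parts: each of the seven monomials q^(T+e) has to be realised by one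
  partition. With three parts the staircase has size 12 and the number of 1's supplies the rest, so
  it equals 7l + e - 12; the values e = 0, 8, 12, 13, 16, 17, 18 give the listed 7l-12, 7l-4, 7l,
  7l+1, 7l+4, 7l+5, 7l+6. The first two are negative for small l. Then q^T (if l \<le> 1) and
  q^(T+8) (if l = 0) are realised with two parts instead, where the staircase has size 6. That in
  turn fails for q^T if l = 0 and j \<le> 1, which leaves one part and staircase 2. Only T = 0
  leaves nothing but the empty partition, which N \<ge> 1 excludes.\<close>

definition qpoch :: "'a::comm_ring_1 \<Rightarrow> nat \<Rightarrow> 'a" where
  "qpoch q n = (\<Prod>i=1..n. 1 - q ^ i)"

lemma qpoch_0 [simp]: "qpoch q 0 = 1"
  and qpoch_Suc: "qpoch q (Suc n) = qpoch q n * (1 - q ^ Suc n)"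
  by (simp_all add: qpoch_def prod.atLeast_Suc_atMost_Suc_shift)

(* In the last equation n - k is truncated only if qbinom q n k = 0. *)
fun qbinom :: "'a::comm_ring_1 \<Rightarrow> nat \<Rightarrow> nat \<Rightarrow> 'a" where
  "qbinom q n 0 = 1"
| "qbinom q 0 (Suc k) = 0"
| "qbinom q (Suc n) (Suc k) = qbinom q n (Suc k) + q ^ (n - k) * qbinom q n k"

lemma qbinom_eq_0: "n < k \<Longrightarrow> qbinom q n k = 0"
  by (induction q n k rule: qbinom.induct) auto

text \<open>The quotient formula for q-binomials without division. The Pascal rule reduces it to 1 -
  q^(n+1) = (1 - q^(n-k)) + q^(n-k) (1 - q^(k+1)).\<close>

lemma qbinom_qpoch:
  "k \<le> n \<Longrightarrow> qbinom q n k * qpoch q k * qpoch q (n - k) = qpoch q n"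
proof (induction q n k rule: qbinom.induct)
  case (3 q n k)
  show ?case
  proof (cases "k = n")
    case True
    then show ?thesis using "3.IH"(2) by (simp add: qbinom_eq_0 qpoch_Suc mult.assoc[symmetric])
  next
    case False
    with "3.prems" obtain d where n: "n = Suc (k + d)"
      by (metis Suc_le_mono add_Suc_right le_Suc_ex le_neq_implies_less less_imp_Suc_add)
    have IH1: "qbinom q n (Suc k) * qpoch q (Suc k) * qpoch q d = qpoch q n"
      using "3.IH"(1) by (simp add: n)
    have IH2: "qbinom q n k * qpoch q k * qpoch q (Suc d) = qpoch q n"
      using "3.IH"(2) by (simp add: n)
    have "qbinom q (Suc n) (Suc k) * qpoch q (Suc k) * qpoch q (Suc n - Suc k) =
        qbinom q n (Suc k) * qpoch q (Suc k) * qpoch q d * (1 - q ^ Suc d)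
        + q ^ Suc d * (1 - q ^ Suc k) * (qbinom q n k * qpoch q k * qpoch q (Suc d))"
      by (simp add: n qpoch_Suc algebra_simps)
    also have "\<dots> = qpoch q n * (1 - q ^ Suc n)"
      unfolding IH1 IH2 by (simp add: n algebra_simps power_add)
    finally show ?thesis by (simp only: qpoch_Suc)
  qed
qed auto

text \<open>The q-binomial theorem in homogeneous form: the second variable x can be set to a power
  of q, which replaces the negative powers in the usual derivation of the triple product.\<close>

lemma gauss_product:
  "(\<Prod>i<m. x - z * q ^ i) =
     (\<Sum>t\<le>m. (-1) ^ t * q ^ (t choose 2) * qbinom q m t * z ^ t * x ^ (m - t))"
proof (induction m)
  case (Suc m)
  define f where "f t = (-1) ^ t * q ^ (t choose 2) * qbinom q m t * z ^ t" for t
  have c2: "Suc t choose 2 = t + (t choose 2)" for t by (simp add: numeral_2_eq_2)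
  have summand: "(-1) ^ Suc t * q ^ (Suc t choose 2) * qbinom q (Suc m) (Suc t) * z ^ Suc t * x ^ (m - t)
     = f (Suc t) * x ^ (m - t) - z * q ^ m * (f t * x ^ (m - t))" if "t \<le> m" for t
  proof -
    \<comment> \<open>The q^t gained by the binomial exponent and the q^(m-t) of the Pascal rule
      combine to q^m, which does not depend on t and leaves the sum.\<close>
    have "q ^ m = q ^ t * q ^ (m - t)" using that by (simp flip: power_add)
    then show ?thesis by (simp add: f_def c2 power_add algebra_simps)
  qed
  have "(\<Sum>t\<le>Suc m. (-1) ^ t * q ^ (t choose 2) * qbinom q (Suc m) t * z ^ t * x ^ (Suc m - t))
      = x ^ Suc m + (\<Sum>t\<le>m. f (Suc t) * x ^ (m - t) - z * q ^ m * (f t * x ^ (m - t)))"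
    unfolding sum.atMost_Suc_shift diff_Suc_Suc
    by (intro arg_cong2[where f = "(+)"] sum.cong refl summand) (simp_all add: binomial_eq_0)
  also have "\<dots> = (x ^ Suc m + (\<Sum>t\<le>m. f (Suc t) * x ^ (m - t)))
      - z * q ^ m * (\<Sum>t\<le>m. f t * x ^ (m - t))"
    by (simp add: sum_subtractf sum_distrib_left)
  also have "x ^ Suc m + (\<Sum>t\<le>m. f (Suc t) * x ^ (m - t)) = (\<Sum>t\<le>Suc m. f t * x ^ (Suc m - t))"
    unfolding sum.atMost_Suc_shift by (simp add: f_def binomial_eq_0)
  also have "\<dots> = (\<Sum>t\<le>m. x * (f t * x ^ (m - t)))"
    by (simp add: f_def qbinom_eq_0 Suc_diff_le mult_ac)
  also have "\<dots> - z * q ^ m * (\<Sum>t\<le>m. f t * x ^ (m - t)) = (\<Prod>i<Suc m. x - z * q ^ i)"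
    using Suc by (simp add: f_def algebra_simps flip: sum_distrib_left)
  finally show ?case ..
qed (simp add: binomial_eq_0)

lemma choose_2_add: "(n + s) choose 2 = (n choose 2) + (s choose 2) + n * s"
  by (induction s) (simp_all add: numeral_2_eq_2 algebra_simps)

lemma square_choose_2: "n * n = 2 * (n choose 2) + n"
  by (induction n) (simp_all add: numeral_2_eq_2)

(* The Gauss product with x = q^n and z = a; dividing it by c brings out both product factors. *)
lemma finite_jacobi_triple_product:
  fixes a b :: "'a::idom"
  assumes "a \<noteq> 0" "b \<noteq> 0" and q: "q = a * b"
  shows "(\<Prod>i<n. (1 - a * q ^ i) * (1 - b * q ^ i)) =
    (\<Sum>s\<le>n. (-1) ^ s * q ^ (s choose 2) * a ^ s * qbinom q (2 * n) (n + s))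
    - (\<Sum>s<n. (-1) ^ s * q ^ (Suc s choose 2) * b ^ Suc s * qbinom q (2 * n) (n - Suc s))"
proof -
  define c where "c = (-1) ^ n * a ^ n * q ^ ((n choose 2) + n * n)"
  have "q \<noteq> 0" "c \<noteq> 0" using assms by (auto simp: c_def)
  define g where "g t = (-1) ^ t * q ^ (t choose 2) * qbinom q (2 * n) t * a ^ t * (q ^ n) ^ (2 * n - t)" for t
  have c2: "(\<Sum>i<n. i) = (n choose 2)"
    by (induction n) (simp_all add: numeral_2_eq_2)
  \<comment> \<open>Taking -a q^i out of a factor leaves 1 - q^(n-i)/a, and q = a b turns the
    quotient into b q^(n-1-i).\<close>
  have low: "(\<Prod>i<n. q ^ n - a * q ^ i) = (-1) ^ n * a ^ n * q ^ (n choose 2) * (\<Prod>i<n. 1 - b * q ^ i)"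
  proof -
    have "(\<Prod>i<n. q ^ n - a * q ^ i) = (\<Prod>i<n. (-1) * (a * (q ^ i * (1 - b * q ^ (n - Suc i)))))"
    proof (rule prod.cong)
      fix i assume "i \<in> {..<n}"
      then have "q ^ n = q ^ i * (q * q ^ (n - Suc i))"
        by (simp flip: power_add power_Suc add: Suc_diff_Suc)
      then show "q ^ n - a * q ^ i = (-1) * (a * (q ^ i * (1 - b * q ^ (n - Suc i))))"
        by (simp add: algebra_simps q)
    qed simp
    also have "\<dots> = (-1) ^ n * a ^ n * q ^ (n choose 2) * (\<Prod>i<n. 1 - b * q ^ (n - Suc i))"
      unfolding prod.distrib prod_constant by (simp flip: c2 add: power_sum mult_ac)
    also have "(\<Prod>i<n. 1 - b * q ^ (n - Suc i)) = (\<Prod>i<n. 1 - b * q ^ i)"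
      by (rule prod.nat_diff_reindex)
    finally show ?thesis .
  qed
  have high: "(\<Prod>i<n. q ^ n - a * q ^ (n + i)) = q ^ (n * n) * (\<Prod>i<n. 1 - a * q ^ i)"
  proof -
    have "(\<Prod>i<n. q ^ n - a * q ^ (n + i)) = (\<Prod>i<n. q ^ n * (1 - a * q ^ i))"
      by (intro prod.cong) (auto simp: power_add algebra_simps)
    then show ?thesis by (simp add: prod.distrib power_mult)
  qed
  have "(\<Prod>i<n + k. q ^ n - a * q ^ i) =
      (\<Prod>i<n. q ^ n - a * q ^ i) * (\<Prod>i<k. q ^ n - a * q ^ (n + i))" for k
    by (induction k) (simp_all add: mult.assoc)
  from this[of n] have prod: "(\<Prod>i<2 * n. q ^ n - a * q ^ i) = c * (\<Prod>i<n. (1 - a * q ^ i) * (1 - b * q ^ i))"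
    unfolding low high mult_2 by (simp add: c_def prod.distrib power_add mult_ac)
  have up: "g (n + s) = c * ((-1) ^ s * q ^ (s choose 2) * a ^ s * qbinom q (2 * n) (n + s))"
    if "s \<le> n" for s
  proof -
    obtain d where n: "n = s + d" using \<open>s \<le> n\<close> le_Suc_ex by blast
    have "((n + s) choose 2) + n * (2 * n - (n + s)) = (n choose 2) + n * n + (s choose 2)"
      by (simp add: choose_2_add n algebra_simps)
    then have "q ^ ((n + s) choose 2) * (q ^ n) ^ (2 * n - (n + s)) = q ^ ((n choose 2) + n * n) * q ^ (s choose 2)"
      by (simp flip: power_add power_mult)
    then show ?thesis by (simp add: g_def c_def power_add mult_ac)
  qed
  have down: "g (n - Suc s) = c * (- ((-1) ^ s * q ^ (Suc s choose 2) * b ^ Suc s * qbinom q (2 * n) (n - Suc s)))"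
    if "s < n" for s
  proof -
    obtain d where n: "n = d + Suc s" using less_imp_Suc_add[OF \<open>s < n\<close>] by (auto simp: add.commute)
    have c2': "Suc s choose 2 = s + (s choose 2)" by (simp add: numeral_2_eq_2)
    \<comment> \<open>The surplus q^(s+1) is a^(s+1) b^(s+1): the power of a completes a^d to a^n,
      the power of b is the one in the target.\<close>
    have "(d choose 2) + n * (n + Suc s) = ((n choose 2) + n * n) + (Suc s choose 2) + Suc s"
      using square_choose_2[of "Suc s"] unfolding n choose_2_add by (simp add: algebra_simps)
    then have e: "q ^ (d choose 2) * (q ^ n) ^ (n + Suc s) = q ^ ((n choose 2) + n * n) * q ^ (Suc s choose 2) * (a ^ Suc s * b ^ Suc s)"
      unfolding q power_mult_distrib[of a b, symmetric] by (simp flip: power_add power_mult)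
    have "g (n - Suc s) = (-1) ^ d * qbinom q (2 * n) d * a ^ d * (q ^ (d choose 2) * (q ^ n) ^ (n + Suc s))"
    proof -
      have "n - Suc s = d" "2 * n - d = n + Suc s" by (simp_all add: n)
      then show ?thesis by (simp add: g_def mult_ac)
    qed
    also have "\<dots> = c * (- ((-1) ^ s * q ^ (Suc s choose 2) * b ^ Suc s * qbinom q (2 * n) d))"
      unfolding e c_def by (simp add: n power_add mult_ac)
    finally show ?thesis by (simp add: n)
  qed
  have "(\<Prod>i<2 * n. q ^ n - a * q ^ i) = (\<Sum>t\<le>2 * n. g t)"
    unfolding gauss_product g_def ..
  also have "\<dots> = (\<Sum>t<n. g t) + (\<Sum>s\<le>n. g (n + s))"
  proof -
    have "{..2 * n} = {..<n} \<union> {n..2 * n}" by auto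
    then have "(\<Sum>t\<le>2 * n. g t) = (\<Sum>t<n. g t) + (\<Sum>t\<in>{n..2 * n}. g t)"
      by (simp add: sum.union_disjoint ivl_disj_int)
    also have "(\<Sum>t\<in>{n..2 * n}. g t) = (\<Sum>s\<le>n. g (n + s))"
      by (rule sum.reindex_bij_witness[of _ "\<lambda>s. n + s" "\<lambda>t. t - n"]) auto
    finally show ?thesis .
  qed
  also have "(\<Sum>t<n. g t) = (\<Sum>s<n. g (n - Suc s))"
    by (rule sum.nat_diff_reindex[symmetric])
  finally have "c * (\<Prod>i<n. (1 - a * q ^ i) * (1 - b * q ^ i)) = c *
     ((\<Sum>s\<le>n. (-1) ^ s * q ^ (s choose 2) * a ^ s * qbinom q (2 * n) (n + s))
    - (\<Sum>s<n. (-1) ^ s * q ^ (Suc s choose 2) * b ^ Suc s * qbinom q (2 * n) (n - Suc s)))"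
    unfolding prod by (simp add: up down right_diff_distrib sum_distrib_left sum_negf)
  then show ?thesis using \<open>c \<noteq> 0\<close> by simp
qed

section \<open>Power series modulo a power of X\<close>

text \<open>Congruence modulo X^M as an equation between truncations, so that reflexivity, symmetry
  and calculational chains are those of equality.\<close>

abbreviation eq_upto :: "nat \<Rightarrow> 'a::comm_ring_1 fps \<Rightarrow> 'a fps \<Rightarrow> bool" where
  "eq_upto M f g \<equiv> fps_cutoff M f = fps_cutoff M g"

lemma eq_upto_mult: "eq_upto M f f' \<Longrightarrow> eq_upto M g g' \<Longrightarrow> eq_upto M (f * g) (f' * g')"
  by (simp add: fps_cutoff_eq_fps_cutoff_iff fps_mult_nth)

lemma eq_upto_diff: "eq_upto M f f' \<Longrightarrow> eq_upto M g g' \<Longrightarrow> eq_upto M (f - g) (f' - g')"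
  by (simp add: fps_cutoff_diff)

lemma eq_upto_sum: "(\<And>x. x \<in> A \<Longrightarrow> eq_upto M (f x) (g x)) \<Longrightarrow> eq_upto M (sum f A) (sum g A)"
  by (simp add: fps_cutoff_eq_fps_cutoff_iff fps_sum_nth)

lemma eq_upto_X_power_mult: "M \<le> e \<Longrightarrow> eq_upto M (fps_X ^ e * f) 0"
  by (simp add: fps_eq_iff fps_X_power_mult_nth)

lemma eq_upto_cancel:
  fixes f g h :: "'a::field fps"
  assumes "eq_upto M (f * g) (f * h)" "fps_nth f 0 \<noteq> 0"
  shows "eq_upto M g h"
proof -
  have "eq_upto M (inverse f * (f * g)) (inverse f * (f * h))"
    using assms(1) by (rule eq_upto_mult[OF refl])
  then show ?thesis
    by (simp add: mult.assoc[symmetric] inverse_mult_eq_1[OF assms(2)])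
qed

lemma qpoch_X_power_nth_0: "d > 0 \<Longrightarrow> fps_nth (qpoch (fps_X ^ d :: 'a::comm_ring_1 fps) n) 0 = 1"
  by (induction n) (simp_all add: qpoch_Suc fps_X_power_nth flip: power_mult power_Suc)

text \<open>Every factor after the M-th is 1 modulo X^M, so the M-th product stands in for the
  infinite one.\<close>

lemma qpoch_eq_upto:
  assumes "d > 0" "M \<le> m"
  shows "eq_upto M (qpoch (fps_X ^ d :: 'a::comm_ring_1 fps) m) (qpoch (fps_X ^ d) M)"
  using assms(2)
proof (induction m rule: dec_induct)
  case (step m)
  have "M \<le> d * Suc m" using step assms by (metis le_SucI le_trans mult_le_mono1 nat_mult_1 Suc_leI One_nat_def)
  then have "eq_upto M (1 - fps_X ^ (d * Suc m) * 1) (1 - 0 :: 'a fps)"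
    by (intro eq_upto_diff eq_upto_X_power_mult refl)
  then have "eq_upto M (1 - (fps_X ^ d) ^ Suc m) (1 :: 'a fps)"
    unfolding power_mult by simp
  from eq_upto_mult[OF step.IH this] show ?case
    by (simp add: qpoch_Suc del: power_Suc)
qed simp

text \<open>Central q-binomials tend to the reciprocal of the infinite product. A second factor
  \<open>qpoch\<close> brings in \<open>qbinom_qpoch\<close> and is cancelled afterwards.\<close>

lemma qbinom_eq_upto:
  assumes "d > 0" "k \<le> n" "M \<le> k" "M \<le> n - k"
  shows "eq_upto M (qpoch (fps_X ^ d :: 'a::field fps) M * qbinom (fps_X ^ d) n k) 1"
proof -
  let ?Q = "fps_X ^ d :: 'a fps"
  have "eq_upto M (qpoch ?Q M * (qpoch ?Q M * qbinom ?Q n k)) (qpoch ?Q (n - k) * (qpoch ?Q k * qbinom ?Q n k))"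
    by (intro eq_upto_mult refl qpoch_eq_upto[symmetric] assms)
  also have "qpoch ?Q (n - k) * (qpoch ?Q k * qbinom ?Q n k) = qpoch ?Q n"
    using qbinom_qpoch[OF \<open>k \<le> n\<close>, of ?Q] by (simp add: mult_ac)
  also have "eq_upto M \<dots> (qpoch ?Q M * 1)"
    using qpoch_eq_upto[OF \<open>d > 0\<close>, of M n] assms by simp
  finally show ?thesis
    by (rule eq_upto_cancel) (simp add: qpoch_X_power_nth_0 assms)
qed

text \<open>It is also the generating function of partitions into parts at most n, see
  \<open>qinv_eq_prod_mult_gf\<close>; this double reading links the analytic half to the
  combinatorial one.\<close>

definition qinv :: "nat \<Rightarrow> 'a::field fps" where
  "qinv n = inverse (qpoch fps_X n)"

lemma qpoch_X_nth_0: "fps_nth (qpoch (fps_X :: 'a::comm_ring_1 fps) n) 0 = 1"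
  using qpoch_X_power_nth_0[of 1 n] by simp

lemma qpoch_qinv: "qpoch fps_X n * qinv n = 1"
  by (simp add: qinv_def inverse_mult_eq_1' qpoch_X_nth_0)

lemma qinv_0 [simp]: "qinv 0 = 1"
  by (simp add: qinv_def)

lemma qinv_rec: "qinv n = (1 - fps_X ^ Suc n) * qinv (Suc n)"
proof -
  have "qinv n = qinv n * (qpoch fps_X (Suc n) * qinv (Suc n))" by (simp add: qpoch_qinv)
  also have "\<dots> = (qpoch fps_X n * qinv n) * ((1 - fps_X ^ Suc n) * qinv (Suc n))"
    by (simp add: qpoch_Suc mult_ac)
  finally show ?thesis by (simp only: qpoch_qinv mult_1_left)
qed

lemma qinv_eq_upto:
  assumes "M \<le> m"
  shows "eq_upto M (qpoch (fps_X :: 'a::field fps) M * qinv m) 1"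
proof -
  have "eq_upto M (qpoch (fps_X :: 'a::field fps) M * qinv m) (qpoch fps_X m * qinv m)"
    using qpoch_eq_upto[of 1 M m, where 'a = 'a] assms by (intro eq_upto_mult) simp_all
  then show ?thesis by (simp only: qpoch_qinv)
qed

lemma qinv_qbinom:
  assumes "k \<le> n"
  shows "qinv n * qbinom fps_X n k = qinv k * qinv (n - k)"
proof -
  have "qinv n * qbinom fps_X n k =
      qinv n * qbinom fps_X n k * (qpoch fps_X k * qinv k) * (qpoch fps_X (n - k) * qinv (n - k))"
    by (simp add: qpoch_qinv)
  also have "\<dots> = qinv n * (qbinom fps_X n k * qpoch fps_X k * qpoch fps_X (n - k)) * (qinv k * qinv (n - k))"
    by (simp only: mult_ac)
  also have "\<dots> = qpoch fps_X n * qinv n * (qinv k * qinv (n - k))"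
    using assms by (simp add: qbinom_qpoch)
  finally show ?thesis by (simp add: qpoch_qinv)
qed

section \<open>The second Rogers-Ramanujan identity\<close>

text \<open>Combinatorially, partitions into at most n+a parts are cut along their Durfee rectangle
  with i+a rows and i columns. The induction needs a arbitrary: the Pascal rule splits the sum into
  the one for (n, a) and, after an index shift, q^(n+a+1) times the one for (n, a+1), and
  \<open>qinv_rec\<close> adds them.\<close>

lemma q_chu_vandermonde_qbinom:
  "(\<Sum>i\<le>n. fps_X ^ (i * i + i * a) * qbinom fps_X n i * qinv (i + a)) = (qinv (n + a) :: 'a::field fps)"
proof (induction n arbitrary: a)
  case (Suc n)
  define g where "g i = fps_X ^ (i * i + i * a) * qbinom fps_X n i * (qinv (i + a) :: 'a fps)" for i
  define h where "h i = fps_X ^ (i * i + i * Suc a) * qbinom fps_X n i * (qinv (i + Suc a) :: 'a fps)" for i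
  have shift: "fps_X ^ (Suc i * Suc i + Suc i * a) * qbinom fps_X (Suc n) (Suc i) * qinv (Suc i + a)
      = g (Suc i) + fps_X ^ Suc (n + a) * h i" if "i \<le> n" for i
  proof -
    have "Suc i * Suc i + Suc i * a + (n - i) = Suc (n + a) + (i * i + i * Suc a)"
      using that by (simp add: algebra_simps)
    then have "fps_X ^ (Suc i * Suc i + Suc i * a) * fps_X ^ (n - i)
        = (fps_X ^ Suc (n + a) * fps_X ^ (i * i + i * Suc a) :: 'a fps)"
      unfolding power_add[symmetric] by (rule arg_cong)
    then show ?thesis
      unfolding g_def h_def qbinom.simps distrib_left distrib_right by (simp add: mult_ac del: power_Suc mult_Suc mult_Suc_right)
  qed
  have "(\<Sum>i\<le>Suc n. fps_X ^ (i * i + i * a) * qbinom fps_X (Suc n) i * qinv (i + a))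
      = g 0 + (\<Sum>i\<le>n. g (Suc i) + fps_X ^ Suc (n + a) * h i)"
    unfolding sum.atMost_Suc_shift
    by (intro arg_cong2[where f = "(+)"] sum.cong refl shift) (simp_all add: g_def)
  also have "\<dots> = (\<Sum>i\<le>Suc n. g i) + fps_X ^ Suc (n + a) * (\<Sum>i\<le>n. h i)"
    unfolding sum.atMost_Suc_shift sum.distrib sum_distrib_left by (simp only: add.assoc)
  also have "(\<Sum>i\<le>Suc n. g i) = (\<Sum>i\<le>n. g i)"
    by (simp add: g_def qbinom_eq_0)
  also have "(\<Sum>i\<le>n. g i) = qinv (n + a)"
    unfolding g_def by (rule Suc)
  also have "(\<Sum>i\<le>n. h i) = qinv (n + Suc a)"
    unfolding h_def by (rule Suc)
  also have "qinv (n + a) + fps_X ^ Suc (n + a) * qinv (n + Suc a) = (qinv (Suc n + a) :: 'a fps)"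
    by (subst qinv_rec) (simp add: algebra_simps)
  finally show ?case .
qed simp

lemma q_chu_vandermonde:
  "(\<Sum>i\<le>n. fps_X ^ (i * i + i * a) * (qinv i * qinv (n - i) * qinv (i + a))) = (qinv n * qinv (n + a) :: 'a::field fps)"
proof -
  have "(\<Sum>i\<le>n. fps_X ^ (i * i + i * a) * (qinv i * qinv (n - i) * qinv (i + a)))
    = (\<Sum>i\<le>n. qinv n * (fps_X ^ (i * i + i * a) * qbinom fps_X n i * (qinv (i + a) :: 'a fps)))"
    by (intro sum.cong refl) (simp add: mult_ac flip: qinv_qbinom)
  then show ?thesis
    by (simp add: q_chu_vandermonde_qbinom flip: sum_distrib_left)
qed

text \<open>\<open>\<gamma>\<close> and \<open>\<beta>\<close> form a Bailey pair relative to q, up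
  to the factor 1 - q. The conclusion has the shape of the assumption, with \<open>\<gamma>\<close>
  weighted by X^(s^2+s), so the step can be iterated. After interchanging the sums, j = s + i turns
  the inner sum into \<open>q_chu_vandermonde\<close> for n - s and a = 2s + 1.\<close>

lemma bailey_step:
  fixes \<gamma> \<beta> :: "nat \<Rightarrow> 'a::field fps"
  assumes "\<And>j. \<beta> j = (\<Sum>s\<le>j. \<gamma> s * (qinv (j - s) * qinv (j + s + 1)))"
  shows "(\<Sum>j\<le>n. fps_X ^ (j * j + j) * qinv (n - j) * \<beta> j)
    = (\<Sum>s\<le>n. fps_X ^ (s * s + s) * \<gamma> s * (qinv (n - s) * qinv (n + s + 1)))"
proof -
  define f where "f j s = fps_X ^ (j * j + j) * qinv (n - j) * (\<gamma> s * (qinv (j - s) * qinv (j + s + 1)))" for j s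
  have inner: "(\<Sum>j\<in>{j \<in> {..n}. s \<le> j}. f j s) = fps_X ^ (s * s + s) * \<gamma> s * (qinv (n - s) * qinv (n + s + 1))"
    if "s \<le> n" for s
  proof -
    have "(\<Sum>j\<in>{j \<in> {..n}. s \<le> j}. f j s) = (\<Sum>i\<le>n - s. f (s + i) s)"
      using that by (intro sum.reindex_bij_witness[of _ "\<lambda>i. s + i" "\<lambda>j. j - s"]) auto
    also have "\<dots> = (\<Sum>i\<le>n - s. fps_X ^ (s * s + s) * \<gamma> s *
        (fps_X ^ (i * i + i * (2 * s + 1)) * (qinv i * qinv (n - s - i) * qinv (i + (2 * s + 1)))))"
    proof (intro sum.cong refl)
      fix i
      have "(s + i) * (s + i) + (s + i) = (s * s + s) + (i * i + i * (2 * s + 1))"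
        by (simp add: algebra_simps)
      then have "fps_X ^ ((s + i) * (s + i) + (s + i)) = (fps_X ^ (s * s + s) * fps_X ^ (i * i + i * (2 * s + 1)) :: 'a fps)"
        unfolding power_add[symmetric] by (rule arg_cong)
      moreover have "s + i + s + 1 = i + (2 * s + 1)" by simp
      ultimately show "f (s + i) s = fps_X ^ (s * s + s) * \<gamma> s *
        (fps_X ^ (i * i + i * (2 * s + 1)) * (qinv i * qinv (n - s - i) * qinv (i + (2 * s + 1))))"
        unfolding f_def by (simp only: mult_ac diff_diff_left add_diff_cancel_left')
    qed
    also have "\<dots> = fps_X ^ (s * s + s) * \<gamma> s * (qinv (n - s) * qinv (n - s + (2 * s + 1)))"
      unfolding sum_distrib_left[symmetric] q_chu_vandermonde ..
    also have "n - s + (2 * s + 1) = n + s + 1" using that by simp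
    finally show ?thesis .
  qed
  have "(\<Sum>j\<le>n. fps_X ^ (j * j + j) * qinv (n - j) * \<beta> j) = (\<Sum>j\<le>n. \<Sum>s\<in>{s \<in> {..n}. s \<le> j}. f j s)"
    unfolding assms f_def sum_distrib_left by (intro sum.cong) auto
  also have "\<dots> = (\<Sum>s\<le>n. \<Sum>j\<in>{j \<in> {..n}. s \<le> j}. f j s)"
    by (rule sum.swap_restrict) simp_all
  also have "\<dots> = (\<Sum>s\<le>n. fps_X ^ (s * s + s) * \<gamma> s * (qinv (n - s) * qinv (n + s + 1)))"
    by (intro sum.cong refl inner) simp
  finally show ?thesis .
qed

(* The unit Bailey pair relative to q, with the terms of index s and -1-s of the bilateral series
   combined, so that all indices and exponents are natural numbers. *)
definition unit_bailey :: "nat \<Rightarrow> 'a::field fps" where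
  "unit_bailey s = (-1) ^ s * fps_X ^ (s choose 2) * (1 - fps_X ^ (2 * s + 1))"

text \<open>The partial sums have a closed form with denominator 1 - X^n, cleared here; this makes
  the orthogonality relation of the unit pair accessible to induction on the upper limit.\<close>

lemma unit_bailey_partial_sum:
  "m < n \<Longrightarrow> (1 - fps_X ^ n) * (\<Sum>s\<le>m. unit_bailey s * (qinv (n - s) * qinv (n + s + 1)))
     = (-1) ^ m * fps_X ^ (Suc m choose 2) * (1 - fps_X ^ Suc m) * (qinv (n - Suc m) * qinv (n + m + 1) :: 'a::field fps)"
proof (induction m)
  case 0
  then obtain d where n: "n = Suc d" using gr0_conv_Suc by auto
  show ?case using qinv_rec[of d, where 'a = 'a]
    by (simp add: unit_bailey_def n numeral_2_eq_2 mult_ac)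
next
  case (Suc m)
  from less_imp_Suc_add[OF Suc.prems] obtain d where n: "n = Suc (Suc (d + m))"
    by (auto simp: add.commute)
  \<comment> \<open>With X^m and X^d as separate variables (n = d+m+2) and \<open>U * V\<close> as
    common factor of all terms, the induction step is a polynomial identity.\<close>
  define A D :: "'a fps" where "A = fps_X ^ m" and "D = fps_X ^ d"
  define U V :: "'a fps" where "U = qinv (Suc d)" and "V = qinv (n + Suc m + 1)"
  have c: "Suc k choose 2 = k + (k choose 2)" for k by (simp add: numeral_2_eq_2)
  have u: "qinv d = (1 - fps_X * D) * U" unfolding U_def D_def by (subst qinv_rec) simp
  have v: "qinv (n + m + 1) = (1 - fps_X ^ 4 * A\<^sup>2 * D) * V"
    unfolding V_def A_def D_def by (subst qinv_rec) (simp add: n power_add numeral_eq_Suc mult_ac)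
  have IH: "(1 - fps_X ^ n) * (\<Sum>s\<le>m. unit_bailey s * (qinv (n - s) * qinv (n + s + 1)))
     = (-1) ^ m * fps_X ^ (Suc m choose 2) * (1 - fps_X * A) * (U * ((1 - fps_X ^ 4 * A\<^sup>2 * D) * V))"
    using Suc.IH Suc.prems unfolding v[symmetric] by (simp add: n U_def A_def)
  have al: "unit_bailey (Suc m) * (qinv (n - Suc m) * qinv (n + Suc m + 1)) =
      - ((-1) ^ m * fps_X ^ (Suc m choose 2) * (1 - fps_X ^ 3 * A\<^sup>2) * (U * V))"
    by (simp add: unit_bailey_def U_def V_def A_def n power_add power2_eq_square numeral_3_eq_3 mult_ac mult_2 mult_2_right)
  have "(1 - fps_X ^ n) * (\<Sum>s\<le>Suc m. unit_bailey s * (qinv (n - s) * qinv (n + s + 1)))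
     = (-1) ^ m * fps_X ^ (Suc m choose 2) * (U * V) *
       ((1 - fps_X * A) * (1 - fps_X ^ 4 * A\<^sup>2 * D) - (1 - fps_X\<^sup>2 * A * D) * (1 - fps_X ^ 3 * A\<^sup>2))"
  proof -
    have x: "fps_X ^ n = fps_X\<^sup>2 * A * D" by (simp add: n A_def D_def power_add power2_eq_square mult_ac)
    show ?thesis
      unfolding sum.atMost_Suc distrib_left IH al unfolding x by (simp add: algebra_simps)
  qed
  also have "(1 - fps_X * A) * (1 - fps_X ^ 4 * A\<^sup>2 * D) - (1 - fps_X\<^sup>2 * A * D) * (1 - fps_X ^ 3 * A\<^sup>2)
      = - (fps_X * A * (1 - fps_X\<^sup>2 * A) * (1 - fps_X * D))"
    by (simp add: algebra_simps power2_eq_square numeral_eq_Suc)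
  also have "(-1) ^ m * fps_X ^ (Suc m choose 2) * (U * V) * (- (fps_X * A * (1 - fps_X\<^sup>2 * A) * (1 - fps_X * D)))
     = (-1) ^ Suc m * fps_X ^ (Suc (Suc m) choose 2) * (1 - fps_X ^ Suc (Suc m)) * (qinv (n - Suc (Suc m)) * qinv (n + Suc m + 1))"
    unfolding c[of "Suc m"] V_def[symmetric]
    by (simp add: n u A_def power_add power2_eq_square mult_ac del: binomial_Suc_Suc)
  finally show ?case .
qed

text \<open>For n > 0 the partial sum up to n-1 and the last term are opposite, because 1/(q)_(2n) =
  (1 - q^(2n+1))/(q)_(2n+1).\<close>

lemma unit_bailey_pair:
  "(\<Sum>s\<le>n. unit_bailey s * (qinv (n - s) * qinv (n + s + 1))) = (if n = 0 then 1 else 0 :: 'a::field fps)"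
proof (cases n)
  case 0
  then show ?thesis using qinv_rec[of 0, where 'a = 'a] by (simp add: unit_bailey_def binomial_eq_0)
next
  case (Suc m)
  then have v: "qinv (n + m + 1) = (1 - fps_X ^ (2 * n + 1)) * (qinv (n + n + 1) :: 'a fps)"
    using qinv_rec[of "n + m + 1"] by (simp add: Suc mult_2 del: power_Suc)
  have "(1 - fps_X ^ n) * (\<Sum>s\<le>n. unit_bailey s * (qinv (n - s) * qinv (n + s + 1))) =
     (1 - fps_X ^ n) * ((-1) ^ m * fps_X ^ (n choose 2) * (qinv (n + m + 1) - (1 - fps_X ^ (2 * n + 1)) * qinv (n + n + 1)) :: 'a fps)"
    using unit_bailey_partial_sum[of m n, where 'a = 'a]
    unfolding Suc sum.atMost_Suc distrib_left
    by (simp add: unit_bailey_def algebra_simps del: binomial_Suc_Suc power_Suc) simp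
  also have "\<dots> = 0" by (simp only: v diff_self mult_zero_right)
  finally have "(1 - fps_X ^ n) * (\<Sum>s\<le>n. unit_bailey s * (qinv (n - s) * qinv (n + s + 1))) = (0 :: 'a fps)" .
  moreover have "(1 - fps_X ^ n :: 'a fps) \<noteq> 0"
  proof
    assume "1 - fps_X ^ n = (0 :: 'a fps)"
    then have "fps_nth (1 - fps_X ^ n) 0 = (0 :: 'a)" by simp
    then show False by (simp add: Suc)
  qed
  ultimately show ?thesis by (simp add: Suc)
qed

lemma rogers_ramanujan_finite:
  "(\<Sum>j\<le>n. fps_X ^ (j * j + j) * (qinv (n - j) * qinv j)) =
   (\<Sum>s\<le>n. fps_X ^ (s * s + s) * (fps_X ^ (s * s + s) * unit_bailey s) * (qinv (n - s) * qinv (n + s + 1) :: 'a::field fps))"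
proof -
  let ?\<delta> = "\<lambda>j. if j = 0 then 1 else 0 :: 'a fps"
  \<comment> \<open>The first Bailey step: against the delta sequence only i = 0 survives, so the
    new sequence is 1/(q)_j.\<close>
  have "(\<Sum>s\<le>j. fps_X ^ (s * s + s) * unit_bailey s * (qinv (j - s) * qinv (j + s + 1))) = (qinv j :: 'a fps)" for j
  proof -
    have "(\<Sum>s\<le>j. fps_X ^ (s * s + s) * unit_bailey s * (qinv (j - s) * qinv (j + s + 1)))
        = (\<Sum>i\<le>j. fps_X ^ (i * i + i) * qinv (j - i) * ?\<delta> i)"
      by (rule bailey_step[symmetric]) (simp only: unit_bailey_pair)
    also have "\<dots> = (\<Sum>i\<le>j. if i = 0 then qinv j else 0)"
      by (intro sum.cong) auto
    finally show ?thesis by simp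
  qed
  from bailey_step[OF this[symmetric]] show ?thesis by (simp only: mult.assoc)
qed

text \<open>The finite identity with n = 2M, multiplied twice by (q)_M. A term with exponent s^2+s
  \<ge> M vanishes; otherwise s < M, so 2M-s and 2M+s+1 are at least M and their reciprocals are
  absorbed. On the left only 1/(q)_(2M-j) is absorbed, so one factor (q)_M remains.\<close>

lemma rogers_ramanujan_theta:
  "eq_upto M (qpoch fps_X M * (\<Sum>j\<le>2 * M. fps_X ^ (j * j + j) * qinv j))
     (\<Sum>s\<le>2 * M. fps_X ^ (s * s + s) * (fps_X ^ (s * s + s) * unit_bailey s) :: 'a::field fps)"
proof -
  let ?P = "qpoch fps_X M :: 'a fps"
  have *: "eq_upto M (fps_X ^ e * f * g) (fps_X ^ e * f)"
    if "e < M \<Longrightarrow> eq_upto M g 1" for e and f g :: "'a fps"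
  proof (cases "e < M")
    case True
    from eq_upto_mult[OF refl that[OF this], of "fps_X ^ e * f"] show ?thesis by simp
  next
    case False
    then show ?thesis by (simp add: eq_upto_X_power_mult mult.assoc)
  qed
  have "eq_upto M (?P * (\<Sum>j\<le>2 * M. fps_X ^ (j * j + j) * qinv j))
     (\<Sum>j\<le>2 * M. fps_X ^ (j * j + j) * (?P * qinv j) * (?P * qinv (2 * M - j)))"
    unfolding sum_distrib_left
  proof (intro eq_upto_sum)
    fix j
    have "eq_upto M (fps_X ^ (j * j + j) * (?P * qinv j) * (?P * qinv (2 * M - j))) (fps_X ^ (j * j + j) * (?P * qinv j))"
      by (intro * qinv_eq_upto) linarith
    then show "eq_upto M (?P * (fps_X ^ (j * j + j) * qinv j)) (fps_X ^ (j * j + j) * (?P * qinv j) * (?P * qinv (2 * M - j)))"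
      by (simp add: mult_ac)
  qed
  also have "(\<Sum>j\<le>2 * M. fps_X ^ (j * j + j) * (?P * qinv j) * (?P * qinv (2 * M - j)))
     = ?P * ?P * (\<Sum>j\<le>2 * M. fps_X ^ (j * j + j) * (qinv (2 * M - j) * qinv j))"
    unfolding sum_distrib_left by (simp only: mult_ac)
  also have "\<dots> = (\<Sum>s\<le>2 * M. fps_X ^ (s * s + s) * (fps_X ^ (s * s + s) * unit_bailey s) *
      ((?P * qinv (2 * M - s)) * (?P * qinv (2 * M + s + 1))))"
    unfolding rogers_ramanujan_finite sum_distrib_left by (simp only: mult_ac)
  also have "eq_upto M \<dots> (\<Sum>s\<le>2 * M. fps_X ^ (s * s + s) * (fps_X ^ (s * s + s) * unit_bailey s))"
  proof (intro eq_upto_sum *)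
    fix s assume "s * s + s < M"
    then have "M \<le> 2 * M - s" "M \<le> 2 * M + s + 1" by linarith+
    from eq_upto_mult[OF this[THEN qinv_eq_upto]]
    show "eq_upto M ((?P * qinv (2 * M - s)) * (?P * qinv (2 * M + s + 1))) 1" by simp
  qed
  finally show ?thesis .
qed

text \<open>The triple product with base X^5, a = X^4 and b = X. The exponents \<open>e s\<close>
  and \<open>f s\<close> of its two halves differ by 2s+1, and \<open>e s\<close> is twice s^2+s
  plus the exponent of \<open>unit_bailey\<close>; so pairing the halves yields the unit pair with
  the weights of two Bailey steps.\<close>

lemma jacobi_theta:
  "eq_upto M (qpoch (fps_X ^ 5) M * (\<Prod>i<2 * M. (1 - fps_X ^ (5 * i + 4)) * (1 - fps_X ^ (5 * i + 1))))
     (\<Sum>s\<le>2 * M. fps_X ^ (s * s + s) * (fps_X ^ (s * s + s) * unit_bailey s) :: 'a::field fps)"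
proof -
  let ?Q = "fps_X ^ 5 :: 'a fps" and ?n = "2 * M"
  let ?P = "qpoch ?Q M"
  have *: "eq_upto M (?P * ((-1) ^ s * fps_X ^ e * qbinom ?Q (2 * ?n) k)) ((-1) ^ s * fps_X ^ e)"
    if "k \<le> 2 * ?n" "e < M \<Longrightarrow> M \<le> k \<and> M \<le> 2 * ?n - k" for s e k
  proof (cases "e < M")
    case True
    with that have "eq_upto M (?P * qbinom ?Q (2 * ?n) k) 1" by (intro qbinom_eq_upto) auto
    from eq_upto_mult[OF refl this, of "(-1) ^ s * fps_X ^ e"] show ?thesis by (simp only: mult_ac mult_1_left mult_1_right)
  next
    case False
    then have "eq_upto M (fps_X ^ e * f) (fps_X ^ e * g)" for f g :: "'a fps"
      by (simp add: eq_upto_X_power_mult)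
    from this[of "?P * (-1) ^ s * qbinom ?Q (2 * ?n) k" "(-1) ^ s"] show ?thesis by (simp only: mult_ac mult_1_left mult_1_right)
  qed
  define e f where "e s = 5 * (s choose 2) + 4 * s" and "f s = 5 * (Suc s choose 2) + Suc s" for s
  have le: "s \<le> e s" "s \<le> f s" for s by (simp_all add: e_def f_def)
  have ef: "f s = e s + (2 * s + 1)" "e s = (s * s + s) + (s * s + s) + (s choose 2)" for s
  proof -
    have "Suc s choose 2 = s + (s choose 2)" by (simp add: numeral_2_eq_2)
    then show "f s = e s + (2 * s + 1)" by (simp add: e_def f_def)
    show "e s = (s * s + s) + (s * s + s) + (s choose 2)"
      unfolding square_choose_2[of s] e_def by simp
  qed
  have "?P * (\<Prod>i<?n. (1 - fps_X ^ (5 * i + 4)) * (1 - fps_X ^ (5 * i + 1)))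
      = ?P * (\<Prod>i<?n. (1 - fps_X ^ 4 * ?Q ^ i) * (1 - fps_X * ?Q ^ i))"
    unfolding power_add power_mult power_one_right by (simp only: mult.commute)
  also have "(\<Prod>i<?n. (1 - fps_X ^ 4 * ?Q ^ i) * (1 - fps_X * ?Q ^ i)) =
      (\<Sum>s\<le>?n. (-1) ^ s * ?Q ^ (s choose 2) * (fps_X ^ 4) ^ s * qbinom ?Q (2 * ?n) (?n + s))
    - (\<Sum>s<?n. (-1) ^ s * ?Q ^ (Suc s choose 2) * fps_X ^ Suc s * qbinom ?Q (2 * ?n) (?n - Suc s))"
    using power_add[of "fps_X :: 'a fps" 4 1] by (intro finite_jacobi_triple_product) simp_all
  also have "\<dots> = (\<Sum>s\<le>?n. (-1) ^ s * fps_X ^ e s * qbinom ?Q (2 * ?n) (?n + s))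
    - (\<Sum>s<?n. (-1) ^ s * fps_X ^ f s * qbinom ?Q (2 * ?n) (?n - Suc s))"
    by (simp only: e_def f_def power_mult power_add mult.assoc)
  also have "?P * \<dots> = (\<Sum>s\<le>?n. ?P * ((-1) ^ s * fps_X ^ e s * qbinom ?Q (2 * ?n) (?n + s)))
    - (\<Sum>s<?n. ?P * ((-1) ^ s * fps_X ^ f s * qbinom ?Q (2 * ?n) (?n - Suc s)))"
    by (simp only: right_diff_distrib sum_distrib_left)
  finally have lhs: "?P * (\<Prod>i<?n. (1 - fps_X ^ (5 * i + 4)) * (1 - fps_X ^ (5 * i + 1))) =
    (\<Sum>s\<le>?n. ?P * ((-1) ^ s * fps_X ^ e s * qbinom ?Q (2 * ?n) (?n + s)))
    - (\<Sum>s<?n. ?P * ((-1) ^ s * fps_X ^ f s * qbinom ?Q (2 * ?n) (?n - Suc s)))" .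
  have up: "eq_upto M (\<Sum>s\<le>?n. ?P * ((-1) ^ s * fps_X ^ e s * qbinom ?Q (2 * ?n) (?n + s)))
      (\<Sum>s\<le>?n. (-1) ^ s * fps_X ^ e s)"
  proof (intro eq_upto_sum *)
    fix s assume "e s < M"
    with le(1)[of s] show "M \<le> ?n + s \<and> M \<le> 2 * ?n - (?n + s)" by linarith
  qed simp
  have down: "eq_upto M (\<Sum>s<?n. ?P * ((-1) ^ s * fps_X ^ f s * qbinom ?Q (2 * ?n) (?n - Suc s)))
      (\<Sum>s<?n. (-1) ^ s * fps_X ^ f s)"
  proof (intro eq_upto_sum *)
    fix s assume "f s < M"
    then have "Suc s \<le> M" by (simp add: f_def)
    then show "M \<le> ?n - Suc s \<and> M \<le> 2 * ?n - (?n - Suc s)" by linarith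
  qed simp
  \<comment> \<open>The second half of the triple product stops one index earlier; the added term
    has exponent at least M.\<close>
  have last: "eq_upto M (\<Sum>s<?n. (-1) ^ s * fps_X ^ f s) (\<Sum>s\<le>?n. (-1) ^ s * fps_X ^ f s :: 'a fps)"
  proof -
    have "M \<le> f ?n" using le(2)[of ?n] by linarith
    from eq_upto_X_power_mult[OF this, of "(-1) ^ ?n"]
    have "eq_upto M ((-1) ^ ?n * fps_X ^ f ?n) (0 :: 'a fps)" by (simp only: mult.commute)
    then show ?thesis
      unfolding lessThan_Suc_atMost[symmetric] sum.lessThan_Suc fps_cutoff_add by simp
  qed
  have rhs: "(\<Sum>s\<le>?n. (-1) ^ s * fps_X ^ e s) - (\<Sum>s\<le>?n. (-1) ^ s * fps_X ^ f s)
      = (\<Sum>s\<le>?n. fps_X ^ (s * s + s) * (fps_X ^ (s * s + s) * unit_bailey s) :: 'a fps)"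
    unfolding sum_subtractf[symmetric] unit_bailey_def ef(1)
    by (intro sum.cong refl) (simp only: ef(2) power_add right_diff_distrib mult_1_left mult_1_right mult_ac)
  show ?thesis
    unfolding lhs rhs[symmetric] by (rule eq_upto_diff[OF up trans[OF down last]])
qed

lemma qpoch_mod_5:
  "qpoch q (5 * n) = qpoch (q ^ 5) n * (\<Prod>i<n. (1 - q ^ (5 * i + 4)) * (1 - q ^ (5 * i + 1)))
     * (\<Prod>i<n. (1 - q ^ (5 * i + 2)) * (1 - q ^ (5 * i + 3)))"
proof (induction n)
  case (Suc n)
  have "5 * Suc n = Suc (Suc (Suc (Suc (Suc (5 * n)))))" by simp
  then have "qpoch q (5 * Suc n) = qpoch q (5 * n) * (1 - q ^ (5 * n + 1)) * (1 - q ^ (5 * n + 2)) *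
      (1 - q ^ (5 * n + 3)) * (1 - q ^ (5 * n + 4)) * (1 - (q ^ 5) ^ Suc n)"
    by (simp only: qpoch_Suc power_mult[symmetric]) (simp add: eval_nat_numeral)
  then show ?case unfolding Suc by (simp only: qpoch_Suc prod.lessThan_Suc mult_ac)
qed simp

lemma fps_nth_0_prod: "fps_nth (prod f A) 0 = (\<Prod>x\<in>A. fps_nth (f x) 0 :: 'a::comm_ring_1)"
  by (induction A rule: infinite_finite_induct) simp_all

text \<open>Both theta congruences have the same right side. In (q)_M, written as a product over
  residues modulo 5, the residues 0, 1 and 4 cancel against the triple product, which leaves 2 and
  3.\<close>

theorem rogers_ramanujan_2_upto:
  "eq_upto M ((\<Prod>i<2 * M. (1 - fps_X ^ (5 * i + 2)) * (1 - fps_X ^ (5 * i + 3)))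
     * (\<Sum>j\<le>2 * M. fps_X ^ (j * j + j) * qinv j)) (1 :: 'a::field fps)"
proof -
  let ?S = "\<Sum>j\<le>2 * M. fps_X ^ (j * j + j) * (qinv j :: 'a fps)"
  let ?A = "\<Prod>i<2 * M. (1 - fps_X ^ (5 * i + 4)) * (1 - fps_X ^ (5 * i + 1)) :: 'a fps"
  let ?B = "\<Prod>i<2 * M. (1 - fps_X ^ (5 * i + 2)) * (1 - fps_X ^ (5 * i + 3)) :: 'a fps"
  let ?Q = "\<lambda>n. qpoch (fps_X ^ 5) n :: 'a fps"
  have Q: "eq_upto M (?Q M) (?Q (2 * M))"
    by (rule qpoch_eq_upto[symmetric]) simp_all
  have "eq_upto M (?Q (2 * M) * ?A * ?B * ?S) (qpoch fps_X M * ?S)"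
    using qpoch_eq_upto[of 1 M "5 * (2 * M)", where 'a = 'a]
    unfolding qpoch_mod_5[symmetric] by (intro eq_upto_mult refl) simp
  also note rogers_ramanujan_theta
  also note jacobi_theta[symmetric]
  also have "eq_upto M (?Q M * ?A) (?Q (2 * M) * ?A)"
    by (intro eq_upto_mult refl Q)
  finally have "eq_upto M ((?Q (2 * M) * ?A) * (?B * ?S)) ((?Q (2 * M) * ?A) * 1)"
    by (simp only: mult.assoc mult_1_right)
  moreover have "fps_nth (?Q (2 * M) * ?A) 0 \<noteq> 0"
    by (simp add: qpoch_X_power_nth_0 fps_nth_0_prod fps_X_power_nth)
  ultimately show ?thesis by (rule eq_upto_cancel)
qed

section \<open>Partitions with restricted multiplicities\<close>

(* The sum of X^(a c) over c in C, for a > 0. *)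
definition mult_gf :: "nat \<Rightarrow> nat set \<Rightarrow> 'a::comm_ring_1 fps" where
  "mult_gf a C = Abs_fps (\<lambda>n. of_bool (a dvd n \<and> n div a \<in> C))"

definition restricted_msets :: "nat set \<Rightarrow> (nat \<Rightarrow> nat set) \<Rightarrow> nat \<Rightarrow> nat multiset set" where
  "restricted_msets S C n = {M. set_mset M \<subseteq> S \<and> (\<forall>a\<in>S. count M a \<in> C a) \<and> sum_mset M = n}"

text \<open>The copies of a are split off, recording their total size i instead of their number; the
  target then has the shape of a Cauchy product.\<close>

lemma restricted_msets_insert:
  assumes "a \<notin> S" "a > 0"
  shows "bij_betw (\<lambda>M. (count M a * a, filter_mset (\<lambda>x. x \<noteq> a) M))
    (restricted_msets (insert a S) C n)
    (SIGMA i:{i \<in> {0..n}. a dvd i \<and> i div a \<in> C a}. restricted_msets S C (n - i))"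
proof (rule bij_betw_byWitness[where f' = "\<lambda>(i, M). replicate_mset (i div a) a + M"])
  have split: "replicate_mset (count M a) a + filter_mset (\<lambda>x. x \<noteq> a) M = M" for M :: "nat multiset"
    by (rule multiset_eqI) simp
  have sum: "count M a * a + sum_mset (filter_mset (\<lambda>x. x \<noteq> a) M) = sum_mset M" for M :: "nat multiset"
    using arg_cong[OF split, of sum_mset M] by simp
  show "\<forall>M\<in>restricted_msets (insert a S) C n. (\<lambda>(i, M). replicate_mset (i div a) a + M)
      (count M a * a, filter_mset (\<lambda>x. x \<noteq> a) M) = M"
    using \<open>a > 0\<close> by (simp add: split)
  have not_in: "a \<notin># M" if "M \<in> restricted_msets S C k" for M k
    using that \<open>a \<notin> S\<close> by (auto simp: restricted_msets_def)
  show "\<forall>p\<in>SIGMA i:{i \<in> {0..n}. a dvd i \<and> i div a \<in> C a}. restricted_msets S C (n - i).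
     (\<lambda>M. (count M a * a, filter_mset (\<lambda>x. x \<noteq> a) M)) ((\<lambda>(i, M). replicate_mset (i div a) a + M) p) = p"
  proof clarify
    fix i M assume i: "a dvd i" and M: "M \<in> restricted_msets S C (n - i)"
    have "filter_mset (\<lambda>x. x \<noteq> a) M = M"
      using not_in[OF M] by (auto simp: filter_mset_eq_conv)
    moreover have "filter_mset (\<lambda>x. x \<noteq> a) (replicate_mset (i div a) a) = {#}" by simp
    ultimately show "count (replicate_mset (i div a) a + M) a * a = i \<and>
      filter_mset (\<lambda>x. x \<noteq> a) (replicate_mset (i div a) a + M) = M"
      using i not_in[OF M] by (simp add: not_in_iff)
  qed
  show "(\<lambda>M. (count M a * a, filter_mset (\<lambda>x. x \<noteq> a) M)) ` restricted_msets (insert a S) C n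
    \<subseteq> (SIGMA i:{i \<in> {0..n}. a dvd i \<and> i div a \<in> C a}. restricted_msets S C (n - i))"
  proof (rule image_subsetI)
    fix M assume M: "M \<in> restricted_msets (insert a S) C n"
    with sum[of M] have n: "n = count M a * a + sum_mset (filter_mset (\<lambda>x. x \<noteq> a) M)"
      by (simp add: restricted_msets_def)
    show "(count M a * a, filter_mset (\<lambda>x. x \<noteq> a) M)
       \<in> (SIGMA i:{i \<in> {0..n}. a dvd i \<and> i div a \<in> C a}. restricted_msets S C (n - i))"
      using M assms by (auto simp: restricted_msets_def n)
  qed
  show "(\<lambda>(i, M). replicate_mset (i div a) a + M) `
     (SIGMA i:{i \<in> {0..n}. a dvd i \<and> i div a \<in> C a}. restricted_msets S C (n - i))
     \<subseteq> restricted_msets (insert a S) C n"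
  proof clarify
    fix i M assume i: "i \<in> {0..n}" "a dvd i" "i div a \<in> C a" and M: "M \<in> restricted_msets S C (n - i)"
    then show "replicate_mset (i div a) a + M \<in> restricted_msets (insert a S) C n"
      using not_in[OF M] assms(1) by (auto simp: restricted_msets_def not_in_iff split: if_splits)
  qed
qed

lemma restricted_msets_gf:
  assumes "finite S" "0 \<notin> S"
  shows "finite (restricted_msets S C n) \<and>
    of_nat (card (restricted_msets S C n)) = fps_nth (\<Prod>a\<in>S. mult_gf a (C a) :: 'a::comm_ring_1 fps) n"
  using assms
proof (induction S arbitrary: n rule: finite_induct)
  case empty
  have "restricted_msets {} C n = (if n = 0 then {{#}} else {})"
    by (auto simp: restricted_msets_def)
  then show ?case by simp
next
  case (insert a S)
  let ?I = "{i \<in> {0..n}. a dvd i \<and> i div a \<in> C a}"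
  let ?F = "\<Prod>a\<in>S. mult_gf a (C a) :: 'a fps"
  have IH: "finite (restricted_msets S C k)" "of_nat (card (restricted_msets S C k)) = fps_nth ?F k" for k
    using insert by auto
  have bij: "bij_betw (\<lambda>M. (count M a * a, filter_mset (\<lambda>x. x \<noteq> a) M))
      (restricted_msets (insert a S) C n) (SIGMA i:?I. restricted_msets S C (n - i))"
    using insert by (intro restricted_msets_insert) auto
  have "finite (restricted_msets (insert a S) C n)"
    unfolding bij_betw_finite[OF bij] by (intro finite_SigmaI IH) simp
  moreover have "of_nat (card (restricted_msets (insert a S) C n)) = (\<Sum>i\<in>?I. fps_nth ?F (n - i))"
    unfolding bij_betw_same_card[OF bij] by (simp add: card_SigmaI IH)
  moreover have "(\<Sum>i\<in>?I. fps_nth ?F (n - i)) = (\<Sum>i\<in>{0..n}. fps_nth (mult_gf a (C a)) i * fps_nth ?F (n - i))"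
    by (rule sum.mono_neutral_cong_left) (auto simp: mult_gf_def)
  ultimately show ?case
    using insert.hyps by (simp add: fps_mult_nth)
qed

text \<open>A weakly decreasing list is determined by its multiset of entries, so the multiset count
  carries over.\<close>

lemma restricted_partitions_gf:
  assumes "finite S" "0 \<notin> S"
  shows "of_nat (card {xs \<in> partitions_of n. set xs \<subseteq> S \<and> (\<forall>a\<in>S. count_list xs a \<in> C a)})
    = fps_nth (\<Prod>a\<in>S. mult_gf a (C a) :: 'a::comm_ring_1 fps) n"
proof -
  have "bij_betw mset {xs \<in> partitions_of n. set xs \<subseteq> S \<and> (\<forall>a\<in>S. count_list xs a \<in> C a)}
      (restricted_msets S C n)"
  proof (rule bij_betw_byWitness[where f' = "\<lambda>M. rev (sorted_list_of_multiset M)"])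
    show "\<forall>xs\<in>{xs \<in> partitions_of n. set xs \<subseteq> S \<and> (\<forall>a\<in>S. count_list xs a \<in> C a)}.
        rev (sorted_list_of_multiset (mset xs)) = xs"
    proof
      fix xs assume "xs \<in> {xs \<in> partitions_of n. set xs \<subseteq> S \<and> (\<forall>a\<in>S. count_list xs a \<in> C a)}"
      then have "sorted (rev xs)" by (simp add: partitions_of_def is_partition_def sorted_wrt_rev)
      then have "sort xs = rev xs" by (metis properties_for_sort mset_rev)
      then show "rev (sorted_list_of_multiset (mset xs)) = xs" by simp
    qed
    show "mset ` {xs \<in> partitions_of n. set xs \<subseteq> S \<and> (\<forall>a\<in>S. count_list xs a \<in> C a)} \<subseteq> restricted_msets S C n"
      by (auto simp: restricted_msets_def partitions_of_def count_mset sum_mset_sum_list)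
    show "(\<lambda>M. rev (sorted_list_of_multiset M)) ` restricted_msets S C n
      \<subseteq> {xs \<in> partitions_of n. set xs \<subseteq> S \<and> (\<forall>a\<in>S. count_list xs a \<in> C a)}"
    proof clarify
      fix M assume M: "M \<in> restricted_msets S C n"
      let ?xs = "rev (sorted_list_of_multiset M)"
      have m: "mset ?xs = M" by simp
      then have "set ?xs = set_mset M" "sum_list ?xs = sum_mset M" "count_list ?xs = count M"
        by (metis set_mset_mset, metis sum_mset_sum_list, metis count_mset ext)
      moreover have "sorted_wrt (\<ge>) ?xs" by (simp add: sorted_wrt_rev)
      ultimately show "?xs \<in> partitions_of n \<and> set ?xs \<subseteq> S \<and> (\<forall>a\<in>S. count_list ?xs a \<in> C a)"
        using M \<open>0 \<notin> S\<close> unfolding restricted_msets_def partitions_of_def is_partition_def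
        by (auto intro!: gr0I)
    qed
  qed simp
  from bij_betw_same_card[OF this] show ?thesis
    using restricted_msets_gf[OF assms, of C n, where 'a = 'a] by simp
qed

lemma mult_gf_UNIV:
  assumes "a > 0"
  shows "(1 - fps_X ^ a) * mult_gf a UNIV = (1 :: 'a::comm_ring_1 fps)"
proof (rule fps_ext)
  fix n
  have "a dvd n \<longleftrightarrow> n = 0 \<or> a \<le> n \<and> a dvd n - a"
    using assms by (metis dvd_0_right dvd_imp_le dvd_minus_self gr0I linorder_not_less)
  then show "fps_nth ((1 - fps_X ^ a) * mult_gf a UNIV) n = fps_nth (1 :: 'a fps) n"
    using assms by (auto simp: left_diff_distrib fps_X_power_mult_nth mult_gf_def)
qed

lemma mult_gf_singleton:
  assumes "a > 0"
  shows "mult_gf a {c} = (fps_X ^ (a * c) :: 'a::comm_ring_1 fps)"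
  using assms by (auto simp: fps_eq_iff mult_gf_def fps_X_power_nth)

text \<open>The difference of two geometric tails. For a = 1 and d = 7 a window of numbers of 1's
  gets the factor 1 - X^7 that belongs to a fixed number of 7's.\<close>

lemma mult_gf_atLeastLessThan:
  assumes "a > 0"
  shows "mult_gf a {c..<c + d} = fps_X ^ (a * c) * (1 - fps_X ^ (a * d)) * (mult_gf a UNIV :: 'a::comm_ring_1 fps)"
proof (rule fps_ext)
  fix n
  show "fps_nth (mult_gf a {c..<c + d}) n = fps_nth (fps_X ^ (a * c) * (1 - fps_X ^ (a * d)) * mult_gf a UNIV :: 'a fps) n"
  proof (cases "a dvd n")
    case True
    then obtain m where n: "n = a * m" by auto
    have "a * m - a * k = a * (m - k)" for k
      by (simp add: right_diff_distrib')
    moreover have "a * c + a * d = a * (c + d)"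
      by (simp add: distrib_left)
    ultimately show ?thesis using assms
      by (auto simp: n mult.assoc left_diff_distrib fps_X_power_mult_nth mult_gf_def)
  next
    case False
    have "\<not> a dvd n - a * k" if "a * k \<le> n" for k
      using False that by (metis dvd_diffD dvd_triv_left)
    from this[of c] this[of "c + d"] show ?thesis using False
      by (auto simp: mult.assoc left_diff_distrib fps_X_power_mult_nth mult_gf_def algebra_simps not_less)
  qed
qed

section \<open>The map col*\<close>

lemma nth_sorted_desc: "sorted_wrt (\<ge>) (xs :: 'a::preorder list) \<Longrightarrow> i \<le> j \<Longrightarrow> j < length xs \<Longrightarrow> xs ! j \<le> xs ! i"
  by (cases "i = j") (auto simp: sorted_wrt_iff_nth_less)

lemma less_length_filter_ge_iff:
  fixes xs :: "'a::linorder list"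
  assumes "sorted_wrt (\<ge>) xs"
  shows "i < length (filter (\<lambda>x. c \<le> x) xs) \<longleftrightarrow> i < length xs \<and> c \<le> xs ! i"
  using assms
proof (induction xs arbitrary: i)
  case (Cons x xs)
  show ?case
  proof (cases "c \<le> x")
    case True
    then show ?thesis using Cons by (cases i) auto
  next
    case False
    then have small: "\<not> c \<le> y" if "y \<in> set (x # xs)" for y
      using Cons.prems that by auto
    then have "filter (\<lambda>x. c \<le> x) (x # xs) = []" by (simp only: filter_empty_conv) blast
    moreover have "\<not> (i < length (x # xs) \<and> c \<le> (x # xs) ! i)"
      using small nth_mem[of i "x # xs"] by blast
    ultimately show ?thesis by (simp only: list.size(3) not_less_zero)
  qed
qed simp

lemma length_conjugate: "length (conjugate xs) = Max (insert 0 (set xs))"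
  by (simp add: conjugate_def)

lemma nth_conjugate:
  "i < length (conjugate xs) \<Longrightarrow> conjugate xs ! i = length (filter (\<lambda>x. Suc i \<le> x) xs)"
  by (simp add: conjugate_def del: upt_Suc)

text \<open>Conjugation transposes the cells of the Ferrers diagram; that the conjugate is weakly
  decreasing and that conjugation is an involution follow from this.\<close>

lemma ferrers_conjugate:
  assumes "is_partition xs"
  shows "i < length (conjugate xs) \<and> c < conjugate xs ! i \<longleftrightarrow> c < length xs \<and> i < xs ! c"
proof -
  have "i < length (conjugate xs)" if "c < length xs" "i < xs ! c"
    unfolding length_conjugate using that nth_mem[OF that(1)] by (intro less_le_trans[OF that(2)] Max_ge) simp_all
  then show ?thesis
    using less_length_filter_ge_iff[of xs c "Suc i"] assms
    by (auto simp: is_partition_def nth_conjugate)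
qed

text \<open>A partition is determined by its cells; since parts are positive, row i exists exactly
  if it contains the cell (i, 0).\<close>

lemma partition_eqI:
  assumes "is_partition xs" "is_partition ys"
    and "\<And>i c. i < length xs \<and> c < xs ! i \<longleftrightarrow> i < length ys \<and> c < ys ! i"
  shows "xs = ys"
proof (rule nth_equalityI)
  have pos: "0 < zs ! i" if "is_partition zs" "i < length zs" for zs i
    using that by (simp add: is_partition_def)
  have *: "i < length xs \<longleftrightarrow> i < length ys" for i
    using assms(3)[of i 0] pos[OF assms(1), of i] pos[OF assms(2), of i] by blast
  then show "length xs = length ys" by (metis linorder_neqE_nat less_irrefl)
  show "xs ! i = ys ! i" if "i < length xs" for i
    using assms(3)[of i "ys ! i"] assms(3)[of i "xs ! i"] that * by auto
qed

lemma is_partition_conjugate: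
  assumes "is_partition xs"
  shows "is_partition (conjugate xs)"
  unfolding is_partition_def
proof
  have "conjugate xs ! j \<le> conjugate xs ! i" if "i < j" "j < length (conjugate xs)" for i j
  proof (rule ccontr)
    assume "\<not> ?thesis"
    with that have "conjugate xs ! i < length xs \<and> j < xs ! (conjugate xs ! i)"
      using ferrers_conjugate[OF assms, of j "conjugate xs ! i"] by simp
    with that show False
      using ferrers_conjugate[OF assms, of i "conjugate xs ! i"] by simp
  qed
  then show "sorted_wrt (\<ge>) (conjugate xs)" by (simp add: sorted_wrt_iff_nth_less)
  have "0 < conjugate xs ! i" if i: "i < length (conjugate xs)" for i
  proof -
    have "Max (insert 0 (set xs)) \<in> insert 0 (set xs)" by (rule Max_in) simp_all
    with i obtain x where "x \<in> set xs" "i < x" unfolding length_conjugate by auto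
    then show ?thesis by (auto simp: nth_conjugate[OF i] filter_empty_conv Suc_le_eq)
  qed
  then show "\<forall>x\<in>set (conjugate xs). 0 < x" by (auto simp: in_set_conv_nth)
qed

lemma conjugate_conjugate: "is_partition xs \<Longrightarrow> conjugate (conjugate xs) = xs"
  by (rule partition_eqI) (simp_all add: is_partition_conjugate ferrers_conjugate)

lemma sum_list_conjugate: "sum_list (conjugate xs) = sum_list xs"
proof -
  \<comment> \<open>Double counting of cells, with a free bound n because the maximum changes when
    the head of the list is removed.\<close>
  have *: "(\<Sum>c\<in>{1..n}. length (filter (\<lambda>x. c \<le> x) xs)) = sum_list xs" if "\<forall>x\<in>set xs. x \<le> n" for n
    using that
  proof (induction xs)
    case (Cons x xs)
    have "(\<Sum>c\<in>{1..n}. length (filter (\<lambda>x. c \<le> x) (x # xs)))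
       = (\<Sum>c\<in>{1..n}. of_bool (c \<le> x) + length (filter (\<lambda>x. c \<le> x) xs))"
      by (intro sum.cong) auto
    also have "\<dots> = card ({1..n} \<inter> {c. c \<le> x}) + sum_list xs"
      using Cons by (simp add: sum.distrib)
    also have "{1..n} \<inter> {c. c \<le> x} = {1..x}" using Cons.prems by auto
    finally show ?case by simp
  qed simp
  have "sum_list (conjugate xs) = (\<Sum>c\<in>{1..Max (insert 0 (set xs))}. length (filter (\<lambda>x. c \<le> x) xs))"
    unfolding conjugate_def interv_sum_list_conv_sum_set_nat set_upt atLeastLessThanSuc_atLeastAtMost ..
  also have "\<dots> = sum_list xs" by (rule *) simp
  finally show ?thesis .
qed

lemma bij_betw_conjugate:
  "bij_betw conjugate {xs \<in> partitions_of n. length xs \<le> m} {xs \<in> partitions_of n. set xs \<subseteq> {1..m}}"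
proof (rule bij_betw_byWitness[where f' = conjugate])
  show "conjugate ` {xs \<in> partitions_of n. length xs \<le> m} \<subseteq> {xs \<in> partitions_of n. set xs \<subseteq> {1..m}}"
  proof (rule image_subsetI)
    fix xs assume xs: "xs \<in> {xs \<in> partitions_of n. length xs \<le> m}"
    have "set (conjugate xs) \<subseteq> {..length xs}"
      by (auto simp: conjugate_def)
    moreover have "is_partition (conjugate xs)"
      using xs by (simp add: partitions_of_def is_partition_conjugate)
    ultimately show "conjugate xs \<in> {xs \<in> partitions_of n. set xs \<subseteq> {1..m}}"
      using xs by (force simp: partitions_of_def sum_list_conjugate is_partition_def Suc_le_eq)
  qed
  show "conjugate ` {xs \<in> partitions_of n. set xs \<subseteq> {1..m}} \<subseteq> {xs \<in> partitions_of n. length xs \<le> m}"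
    by (auto 0 3 simp: partitions_of_def is_partition_conjugate sum_list_conjugate length_conjugate)
qed (auto simp: partitions_of_def conjugate_conjugate)

text \<open>Removing the staircase can leave trailing zeros. Keeping them fixes the length at m, so
  that the removal is inverted entry by entry.\<close>

definition padded_partitions :: "nat \<Rightarrow> nat \<Rightarrow> nat list set" where
  "padded_partitions m n = {xs. sorted_wrt (\<ge>) xs \<and> length xs = m \<and> sum_list xs = n}"

lemma filter_pos_sorted_desc:
  "sorted_wrt (\<ge>) (xs :: nat list) \<Longrightarrow>
    filter (\<lambda>x. 0 < x) xs @ replicate (length xs - length (filter (\<lambda>x. 0 < x) xs)) 0 = xs"
proof (induction xs)
  case (Cons x xs)
  show ?case
  proof (cases "x = 0")
    case True
    then have "\<forall>y\<in>set (x # xs). y = 0" using Cons.prems by auto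
    then have "filter (\<lambda>x. 0 < x) (x # xs) = []" "replicate (length (x # xs)) 0 = x # xs"
      by (simp add: filter_empty_conv, intro replicate_length_same) blast
    then show ?thesis by (simp del: filter.simps)
  qed (use Cons in auto)
qed simp

lemma bij_betw_filter_pos:
  "bij_betw (filter (\<lambda>x. 0 < x)) (padded_partitions m n) {xs \<in> partitions_of n. length xs \<le> m}"
proof (rule bij_betw_byWitness[where f' = "\<lambda>xs. xs @ replicate (m - length xs) 0"])
  show "\<forall>xs\<in>padded_partitions m n.
      filter (\<lambda>x. 0 < x) xs @ replicate (m - length (filter (\<lambda>x. 0 < x) xs)) 0 = xs"
    using filter_pos_sorted_desc by (auto simp: padded_partitions_def)
  show "\<forall>xs\<in>{xs \<in> partitions_of n. length xs \<le> m}. filter (\<lambda>x. 0 < x) (xs @ replicate (m - length xs) 0) = xs"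
    by (auto simp: partitions_of_def is_partition_def)
  have "sum_list (filter (\<lambda>x. 0 < x) xs) = sum_list xs" for xs :: "nat list"
    by (induction xs) auto
  then show "filter (\<lambda>x. 0 < x) ` padded_partitions m n \<subseteq> {xs \<in> partitions_of n. length xs \<le> m}"
    by (auto simp: padded_partitions_def partitions_of_def is_partition_def sorted_wrt_filter)
  show "(\<lambda>xs. xs @ replicate (m - length xs) 0) ` {xs \<in> partitions_of n. length xs \<le> m} \<subseteq> padded_partitions m n"
    by (auto simp: padded_partitions_def partitions_of_def is_partition_def sorted_wrt_append nth_append sorted_wrt_iff_nth_less)
qed

text \<open>Induction from the last part, which is at least 2 because 0 and 1 are excluded; each
  earlier part gains at least 2.\<close>

lemma Diff2_star_ge:
  assumes "xs \<in> Diff2_star" "i < length xs"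
  shows "2 * (length xs - i) \<le> xs ! i"
  using assms(2)
proof (induction "length xs - i" arbitrary: i)
  case (Suc k)
  have part: "0 < xs ! i" "1 \<noteq> xs ! i"
    using assms(1) Suc.prems nth_mem[of i xs] by (auto simp: Diff2_star_def Diff2_def is_partition_def simp del: nth_mem)
  show ?case
  proof (cases "Suc i < length xs")
    case True
    then have "2 * (length xs - Suc i) \<le> xs ! Suc i" using Suc by auto
    moreover have "xs ! Suc i + 2 \<le> xs ! i" using assms(1) True by (simp add: Diff2_star_def Diff2_def)
    ultimately show ?thesis by simp
  next
    case False
    then have "length xs - i = 1" using Suc.prems by simp
    then show ?thesis using part by simp
  qed
qed simp

lemma sum_staircase:
  fixes m :: nat
  shows "(\<Sum>i<m. 2 * (m - i)) = m * (m + 1)"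
proof -
  have "(\<Sum>i<m. 2 * (m - i)) = (\<Sum>i<m. 2 * Suc i)"
    by (rule sum.reindex_bij_witness[of _ "\<lambda>i. m - Suc i" "\<lambda>i. m - Suc i"]) auto
  also have "\<dots> = m * (m + 1)" by (induction m) simp_all
  finally show ?thesis .
qed

text \<open>Neighbouring entries lose amounts that differ by 2, so gaps of at least 2 become weak
  descents, and a last part of at least 2 becomes any number.\<close>

lemma bij_betw_remove_staircase:
  "bij_betw (\<lambda>xs. map (\<lambda>i. xs ! i - 2 * (length xs - i)) [0..<length xs])
    {xs \<in> partitions_of (n + m * (m + 1)). xs \<in> Diff2_star \<and> length xs = m} (padded_partitions m n)"
proof (rule bij_betw_byWitness[where f' = "\<lambda>ys. map (\<lambda>i. ys ! i + 2 * (m - i)) [0..<m]"])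
  let ?f = "\<lambda>xs. map (\<lambda>i. xs ! i - 2 * (length xs - i)) [0..<length xs]"
  let ?g = "\<lambda>ys. map (\<lambda>i. ys ! i + 2 * (m - i)) [0..<m]"
  let ?A = "{xs \<in> partitions_of (n + m * (m + 1)). xs \<in> Diff2_star \<and> length xs = m}"
  show gf: "\<forall>xs\<in>?A. ?g (?f xs) = xs"
  proof
    fix xs assume xs: "xs \<in> ?A"
    then show "?g (?f xs) = xs"
      using Diff2_star_ge[of xs] by (intro nth_equalityI) auto
  qed
  show "\<forall>ys\<in>padded_partitions m n. ?f (?g ys) = ys"
    by (auto intro!: nth_equalityI simp: padded_partitions_def)
  have sum_g: "sum_list (?g ys) = sum_list ys + m * (m + 1)" if "length ys = m" for ys
    using that sum_staircase[of m] by (simp add: sum_list_sum_nth sum.distrib lessThan_atLeast0)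
  show "?f ` ?A \<subseteq> padded_partitions m n"
  proof (rule image_subsetI)
    fix xs assume xs: "xs \<in> ?A"
    then have len: "length xs = m" by simp
    have step: "xs ! Suc i + 2 \<le> xs ! i" if "Suc i < m" for i
      using xs that by (auto simp: Diff2_star_def Diff2_def)
    have desc: "sorted_wrt (\<ge>) (?f xs)"
    proof (subst sorted_wrt_iff_nth_Suc_transp)
      show "\<forall>i. Suc i < length (?f xs) \<longrightarrow> ?f xs ! Suc i \<le> ?f xs ! i"
        using xs step by fastforce
    qed (rule transp_on_ge)
    have "sum_list xs = sum_list (?f xs) + m * (m + 1)"
      using sum_g[of "?f xs"] gf xs by simp
    moreover have "sum_list xs = n + m * (m + 1)"
      using xs by (simp add: partitions_of_def)
    ultimately have "sum_list (?f xs) = n" by linarith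
    with desc len show "?f xs \<in> padded_partitions m n"
      by (simp add: padded_partitions_def)
  qed
  show "?g ` padded_partitions m n \<subseteq> ?A"
  proof (rule image_subsetI)
    fix ys assume "ys \<in> padded_partitions m n"
    then have ys: "sorted_wrt (\<ge>) ys" "length ys = m" "sum_list ys = n"
      by (simp_all add: padded_partitions_def)
    have desc: "?g ys ! j + 2 * (j - i) \<le> ?g ys ! i" if "i < j" "j < m" for i j
      using nth_sorted_desc[OF ys(1), of i j] that ys(2) by simp
    have "sorted_wrt (\<ge>) (?g ys)"
      unfolding sorted_wrt_iff_nth_less using desc by fastforce
    moreover have "2 \<le> x" if "x \<in> set (?g ys)" for x
      using that by auto
    moreover have "?g ys ! Suc i + 2 \<le> ?g ys ! i" if "Suc i < length (?g ys)" for i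
      using desc[of i "Suc i"] that by simp
    ultimately show "?g ys \<in> ?A"
      using sum_g[OF ys(2)] ys by (fastforce simp: partitions_of_def Diff2_star_def Diff2_def is_partition_def)
  qed
qed

lemma bij_betw_col_star:
  "bij_betw col_star {xs \<in> partitions_of (n + m * (m + 1)). xs \<in> Diff2_star \<and> length xs = m}
    {xs \<in> partitions_of n. set xs \<subseteq> {1..m}}"
proof -
  have "col_star = conjugate \<circ> (filter (\<lambda>x. 0 < x) \<circ> (\<lambda>xs. map (\<lambda>i. xs ! i - 2 * (length xs - i)) [0..<length xs]))"
    by (simp add: col_star_def fun_eq_iff)
  then show ?thesis
    using bij_betw_trans[OF bij_betw_trans[OF bij_betw_remove_staircase bij_betw_filter_pos] bij_betw_conjugate]
    by simp
qed

lemma Diff2_star_sum_ge: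
  assumes "xs \<in> Diff2_star"
  shows "length xs * (length xs + 1) \<le> sum_list xs"
  unfolding sum_staircase[symmetric] sum_list_sum_nth lessThan_atLeast0
  using Diff2_star_ge[OF assms] by (intro sum_mono) auto

text \<open>The guard is essential: if the staircase exceeds N there is no such partition, whereas
  the truncated difference would count partitions of 0.\<close>

lemma card_Diff2_star_col_star:
  "card {xs \<in> partitions_of N. xs \<in> Diff2_star \<and> length xs = m \<and> Q (col_star xs)} =
     (if m * (m + 1) \<le> N then card {xs \<in> partitions_of (N - m * (m + 1)). set xs \<subseteq> {1..m} \<and> Q xs} else 0)"
proof (cases "m * (m + 1) \<le> N")
  case True
  then obtain n where N: "N = n + m * (m + 1)" by (metis le_add_diff_inverse2)
  have "bij_betw col_star {xs \<in> partitions_of N. xs \<in> Diff2_star \<and> length xs = m \<and> Q (col_star xs)}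
     {xs \<in> partitions_of n. set xs \<subseteq> {1..m} \<and> Q xs}"
    using bij_betw_col_star[of n m] unfolding bij_betw_def N[symmetric] by (auto simp: inj_on_def)
  with True show ?thesis by (simp add: bij_betw_same_card N)
next
  case False
  then have "{xs \<in> partitions_of N. xs \<in> Diff2_star \<and> length xs = m \<and> Q (col_star xs)} = {}"
    using Diff2_star_sum_ge by (fastforce simp: partitions_of_def)
  with False show ?thesis by (simp only: card.empty if_False)
qed

section \<open>Generating functions for the two sides\<close>

lemma prod_mult_gf_UNIV:
  assumes "0 \<notin> S"
  shows "(\<Prod>a\<in>S. 1 - fps_X ^ a) * (\<Prod>a\<in>S. mult_gf a UNIV) = (1 :: 'a::comm_ring_1 fps)"
proof -
  have "(\<Prod>a\<in>S. (1 - fps_X ^ a) * mult_gf a UNIV) = (\<Prod>a\<in>S. 1 :: 'a fps)"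
    using assms by (intro prod.cong refl mult_gf_UNIV) (auto intro: gr0I)
  then show ?thesis by (simp add: prod.distrib)
qed

lemma qinv_eq_prod_mult_gf: "qinv m = (\<Prod>a\<in>{1..m}. mult_gf a UNIV :: 'a::field fps)"
proof -
  let ?A = "\<Prod>a\<in>{1..m}. mult_gf a UNIV :: 'a fps"
  have A: "qpoch fps_X m * ?A = 1"
    unfolding qpoch_def by (rule prod_mult_gf_UNIV) simp
  have "qinv m = qinv m * (qpoch fps_X m * ?A)" by (simp only: A mult_1_right)
  also have "\<dots> = (qpoch fps_X m * qinv m) * ?A" by (simp only: mult_ac)
  finally show ?thesis by (simp only: qpoch_qinv mult_1_left)
qed

text \<open>Measuring each restricted factor against the unrestricted one separates the restrictions
  from the set of parts, so the same weight applies to every S containing B.\<close>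

lemma prod_mult_gf_restrict:
  assumes "finite S" "B \<subseteq> S"
    and "\<And>a. a \<in> B \<Longrightarrow> mult_gf a (C a) = w a * mult_gf a UNIV"
    and "\<And>a. a \<in> S - B \<Longrightarrow> C a = UNIV"
  shows "(\<Prod>a\<in>S. mult_gf a (C a)) = (\<Prod>a\<in>B. w a) * (\<Prod>a\<in>S. mult_gf a UNIV :: 'a::comm_ring_1 fps)"
proof -
  have split: "(\<Prod>a\<in>S. f a) = (\<Prod>a\<in>S - B. f a) * (\<Prod>a\<in>B. f a)" for f :: "nat \<Rightarrow> 'a fps"
    using assms(1,2) by (intro prod.subset_diff) auto
  have "(\<Prod>a\<in>S. mult_gf a (C a)) = (\<Prod>a\<in>S - B. mult_gf a UNIV) * (\<Prod>a\<in>B. w a * mult_gf a UNIV)"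
    unfolding split[of "\<lambda>a. mult_gf a (C a)"]
    by (intro arg_cong2[where f = "(*)"] prod.cong) (auto simp: assms(3,4))
  also have "\<dots> = (\<Prod>a\<in>B. w a) * ((\<Prod>a\<in>S - B. mult_gf a UNIV) * (\<Prod>a\<in>B. mult_gf a UNIV))"
    by (simp only: prod.distrib mult_ac)
  finally show ?thesis unfolding split[of "\<lambda>a. mult_gf a UNIV"] .
qed

lemma mult_gf_singleton_UNIV:
  assumes "a > 0"
  shows "mult_gf a {c} = fps_X ^ (a * c) * (1 - fps_X ^ a) * (mult_gf a UNIV :: 'a::comm_ring_1 fps)"
  by (simp only: mult_gf_singleton[OF assms] mult.assoc mult_gf_UNIV[OF assms] mult_1_right)

definition W237 :: "rat fps" where
  "W237 = (1 - fps_X ^ 2) * (1 - fps_X ^ 3) * (1 - fps_X ^ 7)"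

lemma partitions_with_237_gf:
  assumes "finite S" "0 \<notin> S" "{2, 3, 7} \<subseteq> S"
  shows "of_nat (card {xs \<in> partitions_of n. set xs \<subseteq> S \<and>
      count_list xs 2 = k \<and> count_list xs 3 = j \<and> count_list xs 7 = l})
    = fps_nth (fps_X ^ (2 * k + 3 * j + 7 * l) * W237 * (\<Prod>a\<in>S. mult_gf a UNIV)) n"
proof -
  define C :: "nat \<Rightarrow> nat set" where "C = (\<lambda>_. UNIV)(2 := {k}, 3 := {j}, 7 := {l})"
  have "{xs \<in> partitions_of n. set xs \<subseteq> S \<and> count_list xs 2 = k \<and> count_list xs 3 = j \<and> count_list xs 7 = l}
    = {xs \<in> partitions_of n. set xs \<subseteq> S \<and> (\<forall>a\<in>S. count_list xs a \<in> C a)}"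
    using assms(3) by (auto simp: C_def)
  \<comment> \<open>\<open>the_elem (C a)\<close> reads off the prescribed multiplicity k, j or
    l.\<close>
  moreover have "(\<Prod>a\<in>S. mult_gf a (C a)) =
      (\<Prod>a\<in>{2, 3, 7}. fps_X ^ (a * the_elem (C a)) * (1 - fps_X ^ a)) * (\<Prod>a\<in>S. mult_gf a UNIV :: rat fps)"
    by (rule prod_mult_gf_restrict[OF assms(1,3)]) (auto simp: C_def intro!: mult_gf_singleton_UNIV)
  moreover have "(\<Prod>a\<in>{2, 3, 7}. fps_X ^ (a * the_elem (C a)) * (1 - fps_X ^ a)) = fps_X ^ (2 * k + 3 * j + 7 * l) * W237"
    by (simp add: C_def W237_def power_add mult_ac)
  ultimately show ?thesis
    using restricted_partitions_gf[OF assms(1,2), of n C, where 'a = rat] by simp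
qed

lemma partitions_with_23_ones_gf:
  assumes "m \<ge> 3"
  shows "of_nat (card {xs \<in> partitions_of n. set xs \<subseteq> {1..m} \<and>
      count_list xs 2 = k \<and> count_list xs 3 = j \<and> count_list xs 1 \<in> {7 * l .. 7 * l + 6}})
    = fps_nth (fps_X ^ (2 * k + 3 * j + 7 * l) * W237 * (\<Prod>a\<in>{1..m}. mult_gf a UNIV)) n"
proof -
  define C :: "nat \<Rightarrow> nat set" where "C = (\<lambda>_. UNIV)(1 := {7 * l..<7 * l + 7}, 2 := {k}, 3 := {j})"
  \<comment> \<open>The part 1 receives the weight that the part 7 has in the other case; with the
    weights of 2 and 3 the product is again \<open>W237\<close>.\<close>
  define w where "w = (\<lambda>a. fps_X ^ (a * the_elem (C a)) * (1 - fps_X ^ a))(1 := fps_X ^ (7 * l) * (1 - fps_X ^ 7 :: rat fps))"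
  have "{7 * l .. 7 * l + 6} = {7 * l..<7 * l + 7}" by auto
  then have "{xs \<in> partitions_of n. set xs \<subseteq> {1..m} \<and>
      count_list xs 2 = k \<and> count_list xs 3 = j \<and> count_list xs 1 \<in> {7 * l .. 7 * l + 6}}
    = {xs \<in> partitions_of n. set xs \<subseteq> {1..m} \<and> (\<forall>a\<in>{1..m}. count_list xs a \<in> C a)}"
    using assms by (auto simp: C_def)
  moreover have "(\<Prod>a\<in>{1..m}. mult_gf a (C a)) = (\<Prod>a\<in>{1, 2, 3}. w a) * (\<Prod>a\<in>{1..m}. mult_gf a UNIV)"
  proof (rule prod_mult_gf_restrict)
    show "mult_gf a (C a) = w a * mult_gf a UNIV" if "a \<in> {1, 2, 3}" for a
      using that mult_gf_atLeastLessThan[of 1 "7 * l" 7, where 'a = rat]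
      by (auto simp: C_def w_def intro!: mult_gf_singleton_UNIV)
  qed (use assms in \<open>auto simp: C_def\<close>)
  moreover have "(\<Prod>a\<in>{1, 2, 3}. w a) = fps_X ^ (2 * k + 3 * j + 7 * l) * W237"
    by (simp add: C_def w_def W237_def power_add mult_ac)
  ultimately show ?thesis
    using restricted_partitions_gf[of "{1..m}" n C, where 'a = rat] by simp
qed

lemma of_nat_card_shift:
  assumes "\<And>n. of_nat (c n) = fps_nth F n"
  shows "of_nat (if e \<le> N then c (N - e) else 0) = fps_nth (fps_X ^ e * F :: 'a::comm_ring_1 fps) N"
  using assms by (simp add: fps_X_power_mult_nth)

text \<open>The finite product is moved to the other side, where its inverse is the generating
  function of partitions into parts from S.\<close>

lemma rogers_ramanujan_2_prod_mult_gf: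
  assumes S: "S = (\<lambda>i. 5 * i + 2) ` {..<2 * M} \<union> (\<lambda>i. 5 * i + 3) ` {..<2 * M}"
  shows "eq_upto M (\<Sum>m\<le>2 * M. fps_X ^ (m * m + m) * qinv m) (\<Prod>a\<in>S. mult_gf a UNIV :: 'a::field fps)"
proof -
  let ?R = "\<Sum>m\<le>2 * M. fps_X ^ (m * m + m) * qinv m :: 'a fps"
  let ?B = "\<Prod>a\<in>S. 1 - fps_X ^ a :: 'a fps"
  let ?A = "\<Prod>a\<in>S. mult_gf a UNIV :: 'a fps"
  have "5 * i + 2 \<noteq> 5 * i' + 3" for i i' :: nat by presburger
  then have disj: "(\<lambda>i. 5 * i + 2) ` {..<2 * M} \<inter> (\<lambda>i. 5 * i + 3) ` {..<2 * M} = {}"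
    by auto
  have B: "?B = (\<Prod>i<2 * M. (1 - fps_X ^ (5 * i + 2)) * (1 - fps_X ^ (5 * i + 3)))"
    unfolding S prod.distrib
    by (subst prod.union_disjoint[OF _ _ disj]) (simp_all add: prod.reindex inj_on_def)
  have BA: "?B * ?A = 1" by (rule prod_mult_gf_UNIV) (auto simp: S)
  have "eq_upto M (?A * (?B * ?R)) (?A * 1)"
    unfolding B by (intro eq_upto_mult refl rogers_ramanujan_2_upto)
  also have "?A * (?B * ?R) = (?B * ?A) * ?R" by (simp only: mult_ac)
  finally show ?thesis by (simp only: BA mult_1_left mult_1_right)
qed

text \<open>N < M serves twice: no part of a partition of N lies beyond the finite set S, and the
  coefficient at N is not affected by working modulo X^M.\<close>

lemma parts_2_3_mod_5_gf:
  assumes "N < M"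
  shows "of_nat (card {mu \<in> partitions_of N. (\<forall>x\<in>set mu. x mod 5 = 2 \<or> x mod 5 = 3) \<and>
       count_list mu 2 = k \<and> count_list mu 3 = j \<and> count_list mu 7 = l})
    = fps_nth (fps_X ^ (2 * k + 3 * j + 7 * l) * W237 * (\<Sum>m\<le>2 * M. fps_X ^ (m * m + m) * qinv m)) N"
proof -
  define S where "S = (\<lambda>i. 5 * i + 2) ` {..<2 * M} \<union> (\<lambda>i. 5 * i + 3) ` {..<2 * M}"
  have S: "x \<in> S \<longleftrightarrow> x div 5 < 2 * M \<and> (x mod 5 = 2 \<or> x mod 5 = 3)" for x
  proof
    assume "x div 5 < 2 * M \<and> (x mod 5 = 2 \<or> x mod 5 = 3)"
    then have "x = 5 * (x div 5) + 2 \<or> x = 5 * (x div 5) + 3" "x div 5 \<in> {..<2 * M}"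
      by (presburger, simp)
    then show "x \<in> S" unfolding S_def by blast
  next
    assume "x \<in> S"
    moreover have "(5 * i + 2) div 5 = i" "(5 * i + 2) mod 5 = 2" "(5 * i + 3) div 5 = i" "(5 * i + 3) mod 5 = 3"
      for i :: nat by presburger+
    ultimately show "x div 5 < 2 * M \<and> (x mod 5 = 2 \<or> x mod 5 = 3)"
      by (auto simp: S_def simp del: div_mult_self1 mod_mult_self1)
  qed
  have "x div 5 < 2 * M" if "mu \<in> partitions_of N" "x \<in> set mu" for mu x
    using that assms member_le_sum_list[of x mu] by (auto simp: partitions_of_def)
  then have "{mu \<in> partitions_of N. (\<forall>x\<in>set mu. x mod 5 = 2 \<or> x mod 5 = 3) \<and>
       count_list mu 2 = k \<and> count_list mu 3 = j \<and> count_list mu 7 = l}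
     = {mu \<in> partitions_of N. set mu \<subseteq> S \<and> count_list mu 2 = k \<and> count_list mu 3 = j \<and> count_list mu 7 = l}"
    by (auto simp: S subset_iff)
  moreover have "of_nat (card \<dots>) = fps_nth (fps_X ^ (2 * k + 3 * j + 7 * l) * W237 * (\<Prod>a\<in>S. mult_gf a UNIV)) N"
  proof (rule partitions_with_237_gf)
    show "finite S" by (simp add: S_def)
    show "0 \<notin> S" "{2, 3, 7} \<subseteq> S" using assms by (auto simp: S)
  qed
  moreover have "eq_upto M (fps_X ^ (2 * k + 3 * j + 7 * l) * W237 * (\<Sum>m\<le>2 * M. fps_X ^ (m * m + m) * qinv m))
     (fps_X ^ (2 * k + 3 * j + 7 * l) * W237 * (\<Prod>a\<in>S. mult_gf a UNIV))"
    by (intro eq_upto_mult refl rogers_ramanujan_2_prod_mult_gf S_def)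
  ultimately show ?thesis
    using assms by (simp add: fps_cutoff_eq_fps_cutoff_iff)
qed

lemma low_order_terms:
  "W237 * (\<Sum>m\<le>3. fps_X ^ (m * m + m) * qinv m)
    = 1 + fps_X ^ 8 + fps_X ^ 12 + fps_X ^ 13 + fps_X ^ 16 + fps_X ^ 17 + fps_X ^ 18"
proof -
  \<comment> \<open>Over the common denominator (q)_3 the prefactor W/(q)_3 is (1 - q^7)/(1 - q);
    the claim, multiplied by 1 - q, is a polynomial identity.\<close>
  have ring: "(1 - x ^ 7) * ((1 - x) * (1 - x ^ 2) * (1 - x ^ 3) + x ^ 2 * ((1 - x ^ 2) * (1 - x ^ 3))
      + x ^ 6 * (1 - x ^ 3) + x ^ 12)
    = (1 + x ^ 8 + x ^ 12 + x ^ 13 + x ^ 16 + x ^ 17 + x ^ 18) * (1 - x)" for x :: "rat fps"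
    by (simp add: algebra_simps flip: power_add power_Suc power_Suc2)
  define u :: "rat fps" where "u = qinv 3"
  have u2: "qinv 2 = (1 - fps_X ^ 3) * u" using qinv_rec[of 2] by (simp add: u_def)
  have u1: "qinv 1 = (1 - fps_X ^ 2) * ((1 - fps_X ^ 3) * u)" 
    unfolding u2[symmetric] using qinv_rec[of 1] by (simp add: numeral_2_eq_2)
  have u0: "(1 - fps_X) * ((1 - fps_X ^ 2) * ((1 - fps_X ^ 3) * u)) = 1" 
    unfolding u1[symmetric] using qinv_rec[of 0, where 'a = rat] by simp
  have "(\<Sum>m\<le>3. fps_X ^ (m * m + m) * qinv m) =
     1 + fps_X ^ 2 * qinv 1 + fps_X ^ 6 * qinv 2 + fps_X ^ 12 * u"
    by (simp add: eval_nat_numeral u_def)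
  also have "\<dots> = ((1 - fps_X) * (1 - fps_X ^ 2) * (1 - fps_X ^ 3) + fps_X ^ 2 * ((1 - fps_X ^ 2) * (1 - fps_X ^ 3))
      + fps_X ^ 6 * (1 - fps_X ^ 3) + fps_X ^ 12) * u"
    unfolding u1 u2 by (simp add: distrib_right mult.assoc u0)
  finally have "W237 * (\<Sum>m\<le>3. fps_X ^ (m * m + m) * qinv m) =
     (1 + fps_X ^ 8 + fps_X ^ 12 + fps_X ^ 13 + fps_X ^ 16 + fps_X ^ 17 + fps_X ^ 18) * (1 - fps_X)
       * ((1 - fps_X ^ 2) * ((1 - fps_X ^ 3) * u))"
    unfolding W237_def ring[symmetric] by (simp only: mult_ac)
  also have "\<dots> = (1 + fps_X ^ 8 + fps_X ^ 12 + fps_X ^ 13 + fps_X ^ 16 + fps_X ^ 17 + fps_X ^ 18) * 1"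
    unfolding mult.assoc u0 ..
  finally show ?thesis by simp
qed

section \<open>The exceptional cases of one, two and three parts\<close>

lemma twos_ones_in_partitions_of: "twos_ones a b \<in> partitions_of n \<longleftrightarrow> n = 2 * a + b"
proof -
  have "sorted_wrt (\<ge>) (replicate b (c :: nat))" for b c
    by (simp add: sorted_wrt_iff_nth_less)
  then show ?thesis
    by (auto simp: partitions_of_def is_partition_def twos_ones_def sorted_wrt_append sum_list_replicate)
qed

lemma set_twos_ones_subset: "set (twos_ones a b) \<subseteq> {1..2}" "set (twos_ones 0 b) \<subseteq> {1..1}"
  by (auto simp: twos_ones_def)

text \<open>Here n + 2 is the size before removing the staircase; both alternatives realise q^T, for
  j = 0 and for j = 1.\<close>

lemma card_one_part:
  "card {xs \<in> partitions_of n. set xs \<subseteq> {1..1} \<and>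
     (xs = twos_ones 0 (2 * k - 2) \<and> k \<ge> 1 \<and> j = 0 \<and> l = 0 \<or>
      xs = twos_ones 0 (2 * k + 1) \<and> j = 1 \<and> l = 0)} =
   of_bool (n + 2 = 2 * k + 3 * j + 7 * l \<and> l = 0 \<and> (j = 0 \<or> j = 1))" (is "card ?A = of_bool ?E")
proof -
  have A: "xs \<in> ?A \<longleftrightarrow> xs = twos_ones 0 (2 * k - 2) \<and> n + 2 = 2 * k \<and> j = 0 \<and> l = 0 \<or>
      xs = twos_ones 0 (2 * k + 1) \<and> n = 2 * k + 1 \<and> j = 1 \<and> l = 0" for xs
    using set_twos_ones_subset(2)[of "2 * k - 2"] set_twos_ones_subset(2)[of "2 * k + 1"]
      twos_ones_in_partitions_of[of 0 "2 * k - 2" n] twos_ones_in_partitions_of[of 0 "2 * k + 1" n]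
    by (cases k) (auto simp del: One_nat_def)
  consider (ones) "n + 2 = 2 * k" "j = 0" "l = 0" | (three) "n = 2 * k + 1" "j = 1" "l = 0" | (none) "\<not> ?E"
    by (cases ?E) (elim conjE disjE, auto)
  then show ?thesis
  proof cases
    case ones
    then have "?A = {twos_ones 0 (2 * k - 2)}" unfolding set_eq_iff A by simp
    with ones show ?thesis by simp
  next
    case three
    then have "?A = {twos_ones 0 (2 * k + 1)}" unfolding set_eq_iff A by simp
    with three show ?thesis by simp
  next
    case none
    then have "?A = {}" unfolding set_eq_iff A by auto
    with none show ?thesis by (simp only: card.empty of_bool_eq)
  qed
qed

text \<open>The staircase has size 6. The exponents 3(j-2) (l = 0) and 3j+1 (l = 1) of 1 realise
  q^T, and 3j+2 (l = 0) realises q^(T+8).\<close>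

lemma card_two_parts:
  "card {xs \<in> partitions_of n. set xs \<subseteq> {1..2} \<and>
     (l = 0 \<and> (j \<ge> 2 \<and> xs = twos_ones k (3 * (j - 2)) \<or> xs = twos_ones k (3 * j + 2)) \<or>
      l = 1 \<and> xs = twos_ones k (3 * j + 1))} =
   of_bool (n + 6 = 2 * k + 3 * j + 7 * l \<and> (l = 0 \<and> j \<ge> 2 \<or> l = 1)) +
   of_bool (n + 6 = 2 * k + 3 * j + 7 * l + 8 \<and> l = 0)" (is "card ?A = of_bool ?E + of_bool ?F")
proof -
  have A: "xs \<in> ?A \<longleftrightarrow> l = 0 \<and> j \<ge> 2 \<and> n = 2 * k + 3 * (j - 2) \<and> xs = twos_ones k (3 * (j - 2)) \<or>
      l = 0 \<and> n = 2 * k + (3 * j + 2) \<and> xs = twos_ones k (3 * j + 2) \<or>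
      l = 1 \<and> n = 2 * k + (3 * j + 1) \<and> xs = twos_ones k (3 * j + 1)" for xs
    unfolding mem_Collect_eq
    using set_twos_ones_subset(1)[of k] twos_ones_in_partitions_of[of k _ n] by blast
  consider (a) "n = 2 * k + 3 * (j - 2)" "j \<ge> 2" "l = 0" | (b) "n = 2 * k + (3 * j + 2)" "l = 0"
    | (c) "n = 2 * k + (3 * j + 1)" "l = 1" | (none) "\<not> ?E" "\<not> ?F"
    by linarith
  then show ?thesis
  proof cases
    case a
    then have "n \<noteq> 2 * k + (3 * j + 2)" by linarith
    with a have "?A = {twos_ones k (3 * (j - 2))}" unfolding set_eq_iff A by simp
    moreover have "?E" "\<not> ?F" using a by auto
    ultimately show ?thesis by simp
  next
    case b
    then have "n \<noteq> 2 * k + 3 * (j - 2)" by linarith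
    with b have "?A = {twos_ones k (3 * j + 2)}" unfolding set_eq_iff A by simp
    moreover have "\<not> ?E" "?F" using b by auto
    ultimately show ?thesis by simp
  next
    case c
    then have "?A = {twos_ones k (3 * j + 1)}" unfolding set_eq_iff A by simp
    moreover have "?E" "\<not> ?F" using c by auto
    ultimately show ?thesis by simp
  next
    case none
    have "xs \<notin> ?A" for xs
    proof
      assume "xs \<in> ?A"
      then have "?E \<or> ?F" unfolding A by linarith
      with none show False by blast
    qed
    then have "?A = {}" by blast
    with none show ?thesis by (simp only: card.empty of_bool_eq add_0)
  qed
qed

text \<open>With the numbers of 2's and 3's fixed, the number of 1's determines the partition, so
  the count is 0 or 1. The integers 7l-12 and 7l-4 are nonnegative only for l \<ge> 2 and l \<ge> 1;
  these bounds are the gaps filled by fewer parts.\<close>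

lemma card_three_parts:
  "card {xs \<in> partitions_of n. set xs \<subseteq> {1..3} \<and> count_list xs 2 = k \<and> count_list xs 3 = j \<and>
     int (count_list xs 1) \<in> {7 * int l, 7 * int l + 1, 7 * int l - 12, 7 * int l - 4,
                  7 * int l + 4, 7 * int l + 5, 7 * int l + 6}} =
   of_bool (\<exists>t\<in>{0, 1, 4, 5, 6}. n = 2 * k + 3 * j + 7 * l + t) +
   of_bool (n + 12 = 2 * k + 3 * j + 7 * l \<and> l \<ge> 2) +
   of_bool (n + 12 = 2 * k + 3 * j + 7 * l + 8 \<and> l \<ge> 1)" (is "card ?A = of_bool ?E + of_bool ?F + of_bool ?G")
proof -
  define D where "D = {c. int c \<in> {7 * int l, 7 * int l + 1, 7 * int l - 12, 7 * int l - 4,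
                  7 * int l + 4, 7 * int l + 5, 7 * int l + 6}}"
  define C :: "nat \<Rightarrow> nat set" where "C = (\<lambda>_. UNIV)(1 := D, 2 := {k}, 3 := {j})"
  have S: "{1..3} = {1, 2, 3 :: nat}" by auto
  have A: "?A = {xs \<in> partitions_of n. set xs \<subseteq> {1..3} \<and> (\<forall>a\<in>{1..3}. count_list xs a \<in> C a)}"
    unfolding S C_def D_def by (intro Collect_cong conj_cong refl) auto
  have "(of_nat (card ?A) :: int) = fps_nth (\<Prod>a\<in>{1..3}. mult_gf a (C a)) n"
    unfolding A by (rule restricted_partitions_gf) auto
  also have "(\<Prod>a\<in>{1..3}. mult_gf a (C a)) = (fps_X ^ (2 * k + 3 * j) * mult_gf 1 D :: int fps)"
    unfolding S by (simp add: C_def mult_gf_singleton power_add mult_ac)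
  also have "fps_nth \<dots> n = of_bool (2 * k + 3 * j \<le> n \<and> n - (2 * k + 3 * j) \<in> D)"
    by (simp add: fps_X_power_mult_nth mult_gf_def)
  also have "(2 * k + 3 * j \<le> n \<and> n - (2 * k + 3 * j) \<in> D) \<longleftrightarrow> ?E \<or> ?F \<or> ?G"
  proof (cases "2 * k + 3 * j \<le> n")
    case True
    then obtain c where n: "n = 2 * k + 3 * j + c" using le_Suc_ex by blast
    have int: "int c = 7 * int l \<longleftrightarrow> c = 7 * l" "int c = 7 * int l + 1 \<longleftrightarrow> c = 7 * l + 1"
      "int c = 7 * int l + 4 \<longleftrightarrow> c = 7 * l + 4" "int c = 7 * int l + 5 \<longleftrightarrow> c = 7 * l + 5"
      "int c = 7 * int l + 6 \<longleftrightarrow> c = 7 * l + 6"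
      "int c = 7 * int l - 12 \<longleftrightarrow> c + 12 = 7 * l \<and> l \<ge> 2"
      "int c = 7 * int l - 4 \<longleftrightarrow> c + 12 = 7 * l + 8 \<and> l \<ge> 1"
      by linarith+
    have "?E \<longleftrightarrow> c = 7 * l \<or> c = 7 * l + 1 \<or> c = 7 * l + 4 \<or> c = 7 * l + 5 \<or> c = 7 * l + 6"
      "?F \<longleftrightarrow> c + 12 = 7 * l \<and> l \<ge> 2" "?G \<longleftrightarrow> c + 12 = 7 * l + 8 \<and> l \<ge> 1"
      unfolding n bex_simps by presburger+
    moreover have "n - (2 * k + 3 * j) \<in> D \<longleftrightarrow> c \<in> D" by (simp add: n)
    moreover have "c \<in> D \<longleftrightarrow> c = 7 * l \<or> c = 7 * l + 1 \<or> c + 12 = 7 * l \<and> l \<ge> 2 \<or>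
        c + 12 = 7 * l + 8 \<and> l \<ge> 1 \<or> c = 7 * l + 4 \<or> c = 7 * l + 5 \<or> c = 7 * l + 6"
      unfolding D_def mem_Collect_eq insert_iff empty_iff int by blast
    ultimately show ?thesis using True by (simp only:) blast
  next
    case False
    then have "\<not> ?E" "\<not> ?F" "\<not> ?G" unfolding bex_simps by presburger+
    with False show ?thesis by blast
  qed
  also have "of_bool (?E \<or> ?F \<or> ?G) = (of_nat (of_bool ?E + of_bool ?F + of_bool ?G) :: int)"
  proof -
    have "\<not> (?E \<and> ?F)" "\<not> (?E \<and> ?G)" "\<not> (?F \<and> ?G)" unfolding bex_simps by presburger+
    then show ?thesis by (cases ?E; cases ?F; cases ?G) (simp_all only: of_bool_eq simp_thms of_nat_add of_nat_0 of_nat_1 add_0 add_0_right)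
  qed
  finally show ?thesis by (simp only: of_nat_eq_iff)
qed

section \<open>Summation over the number of parts and comparison of coefficients\<close>

lemma card_Diff2_star_by_length:
  assumes "1 \<le> N" "N \<le> b"
  shows "card {xs \<in> partitions_of N. xs \<in> Diff2_star \<and> P (length xs) (col_star xs)} =
    (\<Sum>m\<in>{1..b}. if m * (m + 1) \<le> N then card {xs \<in> partitions_of (N - m * (m + 1)). set xs \<subseteq> {1..m} \<and> P m xs} else 0)"
proof -
  let ?R = "\<lambda>m. {xs \<in> partitions_of N. xs \<in> Diff2_star \<and> length xs = m \<and> P m (col_star xs)}"
  have "length xs \<in> {1..b}" if "xs \<in> partitions_of N" for xs
  proof -
    have "length ys \<le> sum_list ys" if "\<forall>x\<in>set ys. 0 < x" for ys :: "nat list"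
      using that by (induction ys) auto
    then show ?thesis
      using that assms by (cases xs) (fastforce simp: partitions_of_def is_partition_def)+
  qed
  then have "{xs \<in> partitions_of N. xs \<in> Diff2_star \<and> P (length xs) (col_star xs)} = (\<Union>m\<in>{1..b}. ?R m)"
    by auto
  also have "card \<dots> = (\<Sum>m\<in>{1..b}. card (?R m))"
    by (rule card_UN_disjoint) (auto intro: finite_subset[OF _ finite_partitions_of[of N]])
  finally show ?thesis unfolding card_Diff2_star_col_star .
qed

text \<open>The number of parts m is a separate argument because it cannot be recovered from col*
  alone.\<close>

definition col_condition :: "nat \<Rightarrow> nat \<Rightarrow> nat \<Rightarrow> nat \<Rightarrow> nat list \<Rightarrow> bool" where
  "col_condition k j l m xs \<longleftrightarrow>
     (m \<ge> 7 \<longrightarrow> count_list xs 2 = k \<and> count_list xs 3 = j \<and> count_list xs 7 = l) \<and>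
     (m \<in> {4, 5, 6} \<longrightarrow> count_list xs 2 = k \<and> count_list xs 3 = j \<and> count_list xs 1 \<in> {7 * l .. 7 * l + 6}) \<and>
     (m = 3 \<longrightarrow> count_list xs 2 = k \<and> count_list xs 3 = j \<and>
        int (count_list xs 1) \<in> {7 * int l, 7 * int l + 1, 7 * int l - 12, 7 * int l - 4,
          7 * int l + 4, 7 * int l + 5, 7 * int l + 6}) \<and>
     (m = 2 \<longrightarrow> (l = 0 \<and> ((j \<ge> 2 \<and> xs = twos_ones k (3 * (j - 2))) \<or> xs = twos_ones k (3 * j + 2))) \<or>
        (l = 1 \<and> xs = twos_ones k (3 * j + 1))) \<and>
     (m = 1 \<longrightarrow> (xs = twos_ones 0 (2 * k - 2) \<and> k \<ge> 1 \<and> j = 0 \<and> l = 0) \<or>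
        (xs = twos_ones 0 (2 * k + 1) \<and> j = 1 \<and> l = 0))"

lemma col_condition_gf:
  assumes "m \<ge> 4"
  shows "of_nat (card {xs \<in> partitions_of n. set xs \<subseteq> {1..m} \<and> col_condition k j l m xs})
    = fps_nth (fps_X ^ (2 * k + 3 * j + 7 * l) * W237 * qinv m) n"
proof (cases "m \<ge> 7")
  case True
  then have "col_condition k j l m xs \<longleftrightarrow> count_list xs 2 = k \<and> count_list xs 3 = j \<and> count_list xs 7 = l" for xs
    by (auto simp: col_condition_def)
  then show ?thesis
    using True partitions_with_237_gf[of "{1..m}" n k j l] by (simp add: qinv_eq_prod_mult_gf)
next
  case False
  with assms have "m \<in> {4, 5, 6}" by auto
  then have "col_condition k j l m xs \<longleftrightarrow>
      count_list xs 2 = k \<and> count_list xs 3 = j \<and> count_list xs 1 \<in> {7 * l .. 7 * l + 6}" for xs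
    unfolding col_condition_def by auto
  then show ?thesis
    using assms partitions_with_23_ones_gf[of m n k j l] by (simp only: qinv_eq_prod_mult_gf)
qed

text \<open>The three alternatives, supplied by one, two and three parts, are disjoint and exhaust
  all pairs (j, l), so q^T occurs exactly once.\<close>

lemma sum_of_bool_low:
  "of_bool (E \<and> l = 0 \<and> (j = 0 \<or> j = 1)) + of_bool (E \<and> (l = 0 \<and> j \<ge> 2 \<or> l = 1)) + of_bool (E \<and> l \<ge> 2) = (of_bool E :: nat)"
  for j l :: nat
  by (cases E; cases "l = 0"; cases "l = 1"; cases "j = 0"; cases "j = 1") simp_all

lemma col_condition_low:
  fixes k j l N :: nat
  defines "T \<equiv> 2 * k + 3 * j + 7 * l"
  assumes "1 \<le> N"
  shows "(\<Sum>m\<in>{1..3}. if m * (m + 1) \<le> N then card {xs \<in> partitions_of (N - m * (m + 1)).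
       set xs \<subseteq> {1..m} \<and> col_condition k j l m xs} else 0)
    = of_bool (N = T) + of_bool (N = T + 8) + of_bool (\<exists>t\<in>{0, 1, 4, 5, 6}. N = T + 12 + t)"
proof -
  let ?c = "\<lambda>m. if m * (m + 1) \<le> N then card {xs \<in> partitions_of (N - m * (m + 1)).
       set xs \<subseteq> {1..m} \<and> col_condition k j l m xs} else 0"
  have shift: "(if e \<le> N then of_bool (A (N - e)) else 0 :: nat) = of_bool B"
    if "\<And>n. N = n + e \<Longrightarrow> A n \<longleftrightarrow> B" "N < e \<Longrightarrow> \<not> B" for e A B
    using that(1)[of "N - e"] that(2) by (cases "e \<le> N") auto
  have one: "?c 1 = of_bool (N = T \<and> l = 0 \<and> (j = 0 \<or> j = 1))"
  proof -
    have "col_condition k j l 1 xs \<longleftrightarrow> xs = twos_ones 0 (2 * k - 2) \<and> k \<ge> 1 \<and> j = 0 \<and> l = 0 \<or>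
        xs = twos_ones 0 (2 * k + 1) \<and> j = 1 \<and> l = 0" for xs
      by (simp add: col_condition_def)
    then have "?c 1 = (if 2 \<le> N then of_bool (N - 2 + 2 = T \<and> l = 0 \<and> (j = 0 \<or> j = 1)) else 0)"
      unfolding T_def using card_one_part[of "N - 2" k j l] by (simp only: one_add_one mult_1_left)
    \<comment> \<open>For N < 2 the right side could hold only with N = T = 0, which N \<ge> 1 rules
      out.\<close>
    also have "\<dots> = of_bool (N = T \<and> l = 0 \<and> (j = 0 \<or> j = 1))"
      using assms(2) unfolding T_def by (intro shift) presburger+
    finally show ?thesis .
  qed
  have two: "?c 2 = of_bool (N = T \<and> (l = 0 \<and> j \<ge> 2 \<or> l = 1)) + of_bool (N = T + 8 \<and> l = 0)"
  proof -
    have "col_condition k j l 2 xs \<longleftrightarrow>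
        l = 0 \<and> (j \<ge> 2 \<and> xs = twos_ones k (3 * (j - 2)) \<or> xs = twos_ones k (3 * j + 2)) \<or>
        l = 1 \<and> xs = twos_ones k (3 * j + 1)" for xs
      by (simp add: col_condition_def)
    moreover have "2 * (2 + 1) = (6 :: nat)" by simp
    ultimately have "?c 2 = (if 6 \<le> N then of_bool (N - 6 + 6 = T \<and> (l = 0 \<and> j \<ge> 2 \<or> l = 1))
        + of_bool (N - 6 + 6 = T + 8 \<and> l = 0) else 0)"
      unfolding T_def using card_two_parts[of "N - 6" l j k] by (simp only:)
    also have "\<dots> = (if 6 \<le> N then of_bool (N - 6 + 6 = T \<and> (l = 0 \<and> j \<ge> 2 \<or> l = 1)) else 0)
        + (if 6 \<le> N then of_bool (N - 6 + 6 = T + 8 \<and> l = 0) else 0)"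
      by (cases "6 \<le> N") (simp_all only: if_True if_False add_0)
    also have "\<dots> = of_bool (N = T \<and> (l = 0 \<and> j \<ge> 2 \<or> l = 1)) + of_bool (N = T + 8 \<and> l = 0)"
      unfolding T_def bex_simps by (intro arg_cong2[where f = "(+)"] shift) presburger+
    finally show ?thesis .
  qed
  have three: "?c 3 = of_bool (\<exists>t\<in>{0, 1, 4, 5, 6}. N = T + 12 + t) + of_bool (N = T \<and> l \<ge> 2) + of_bool (N = T + 8 \<and> l \<ge> 1)"
  proof -
    have "col_condition k j l 3 xs \<longleftrightarrow> count_list xs 2 = k \<and> count_list xs 3 = j \<and>
     int (count_list xs 1) \<in> {7 * int l, 7 * int l + 1, 7 * int l - 12, 7 * int l - 4,
                  7 * int l + 4, 7 * int l + 5, 7 * int l + 6}" for xs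
      by (simp add: col_condition_def)
    moreover have "3 * (3 + 1) = (12 :: nat)" by simp
    ultimately have "?c 3 = (if 12 \<le> N then of_bool (\<exists>t\<in>{0, 1, 4, 5, 6}. N - 12 = T + t)
        + of_bool (N - 12 + 12 = T \<and> l \<ge> 2) + of_bool (N - 12 + 12 = T + 8 \<and> l \<ge> 1) else 0)"
      unfolding T_def using card_three_parts[of "N - 12" k j l] by (simp only:)
    also have "\<dots> = (if 12 \<le> N then of_bool (\<exists>t\<in>{0, 1, 4, 5, 6}. N - 12 = T + t) else 0)
        + (if 12 \<le> N then of_bool (N - 12 + 12 = T \<and> l \<ge> 2) else 0)
        + (if 12 \<le> N then of_bool (N - 12 + 12 = T + 8 \<and> l \<ge> 1) else 0)"
      by (cases "12 \<le> N") (simp_all only: if_True if_False add_0)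
    also have "\<dots> = of_bool (\<exists>t\<in>{0, 1, 4, 5, 6}. N = T + 12 + t) + of_bool (N = T \<and> l \<ge> 2) + of_bool (N = T + 8 \<and> l \<ge> 1)"
      unfolding T_def bex_simps by (intro arg_cong2[where f = "(+)"] shift) presburger+
    finally show ?thesis .
  qed
  have eight: "of_bool (N = T + 8 \<and> l = 0) + of_bool (N = T + 8 \<and> l \<ge> 1) = (of_bool (N = T + 8) :: nat)"
    by (cases "N = T + 8"; cases "l = 0") simp_all
  have "{1..3} = {1, 2, 3 :: nat}" by auto
  then have "(\<Sum>m\<in>{1..3}. ?c m) = ?c 1 + (?c 2 + ?c 3)" by simp
  then show ?thesis
    unfolding one two three using sum_of_bool_low[of "N = T" l j] eight by linarith
qed

theorem corollary3:
  fixes N k j l :: nat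
  assumes "N \<ge> 1"
  shows "card {mu \<in> partitions_of N.
            (\<forall>x\<in>set mu. x mod 5 = 2 \<or> x mod 5 = 3) \<and>
            count_list mu 2 = k \<and> count_list mu 3 = j \<and> count_list mu 7 = l}
       = card {lam \<in> partitions_of N. lam \<in> Diff2_star \<and>
            (length lam \<ge> 7 \<longrightarrow>
               count_list (col_star lam) 2 = k \<and> count_list (col_star lam) 3 = j \<and>
               count_list (col_star lam) 7 = l) \<and>
            (length lam \<in> {4, 5, 6} \<longrightarrow>
               count_list (col_star lam) 2 = k \<and> count_list (col_star lam) 3 = j \<and>
               count_list (col_star lam) 1 \<in> {7 * l .. 7 * l + 6}) \<and>
            (length lam = 3 \<longrightarrow>
               count_list (col_star lam) 2 = k \<and> count_list (col_star lam) 3 = j \<and>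
               int (count_list (col_star lam) 1) \<in>
                 {7 * int l, 7 * int l + 1, 7 * int l - 12, 7 * int l - 4,
                  7 * int l + 4, 7 * int l + 5, 7 * int l + 6}) \<and>
            (length lam = 2 \<longrightarrow>
               (l = 0 \<and>
                  ((j \<ge> 2 \<and> col_star lam = twos_ones k (3 * (j - 2))) \<or>
                   col_star lam = twos_ones k (3 * j + 2))) \<or>
               (l = 1 \<and> col_star lam = twos_ones k (3 * j + 1))) \<and>
            (length lam = 1 \<longrightarrow>
               (col_star lam = twos_ones 0 (2 * k - 2) \<and> k \<ge> 1 \<and> j = 0 \<and> l = 0) \<or>
               (col_star lam = twos_ones 0 (2 * k + 1) \<and> j = 1 \<and> l = 0))}"
  unfolding col_condition_def[symmetric]
proof -
  define T F where "T = 2 * k + 3 * j + 7 * l" and "F = fps_X ^ T * W237"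
  let ?g = "\<lambda>m. fps_X ^ (m * m + m) * qinv m :: rat fps"
  let ?c = "\<lambda>m. if m * (m + 1) \<le> N then card {xs \<in> partitions_of (N - m * (m + 1)).
       set xs \<subseteq> {1..m} \<and> col_condition k j l m xs} else 0"
  \<comment> \<open>The upper limit 2M of the Rogers-Ramanujan sum for M = N + 1, the least M that
    determines the coefficient at N.\<close>
  let ?b = "2 * Suc N"
  \<comment> \<open>The left sum starts at m = 1, the right one at m = 0: the term W of index 0
    counts no partition, but is needed to obtain the polynomial.\<close>
  have low: "of_nat (\<Sum>m\<in>{1..3}. ?c m) = fps_nth (F * (\<Sum>m\<le>3. ?g m)) N"
  proof -
    have "F * (\<Sum>m\<le>3. ?g m) = fps_X ^ T + fps_X ^ (T + 8) + fps_X ^ (T + 12) + fps_X ^ (T + 13)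
        + fps_X ^ (T + 16) + fps_X ^ (T + 17) + fps_X ^ (T + 18)"
      unfolding F_def mult.assoc low_order_terms by (simp only: power_add distrib_left mult_1_right)
    moreover have "of_nat (\<Sum>m\<in>{1..3}. ?c m) = (of_bool (N = T) + of_bool (N = T + 8)
        + of_bool (\<exists>t\<in>{0, 1, 4, 5, 6}. N = T + 12 + t) :: rat)"
      unfolding col_condition_low[OF assms] T_def[symmetric] by (simp only: of_nat_add of_nat_of_bool)
    ultimately show ?thesis by (auto simp: fps_X_power_nth)
  qed
  have high: "of_nat (?c m) = fps_nth (F * ?g m) N" if "m \<in> {4..?b}" for m
  proof -
    have "of_nat (?c m) = fps_nth (fps_X ^ (m * (m + 1)) * (fps_X ^ (2 * k + 3 * j + 7 * l) * W237 * qinv m)) N"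
      using that by (intro of_nat_card_shift col_condition_gf) simp
    also have "fps_X ^ (m * (m + 1)) * (fps_X ^ (2 * k + 3 * j + 7 * l) * W237 * qinv m) = F * ?g m"
      by (simp add: F_def T_def mult_ac)
    finally show ?thesis .
  qed
  have ranges: "{1..?b} = {1..3} \<union> {4..?b}" "{..?b} = {..3} \<union> {4..?b}"
    using assms by auto
  have "of_nat (card {lam \<in> partitions_of N. lam \<in> Diff2_star \<and> col_condition k j l (length lam) (col_star lam)})
      = of_nat (\<Sum>m\<in>{1..?b}. ?c m)"
    using card_Diff2_star_by_length[of N ?b "col_condition k j l"] assms by simp
  also have "(\<Sum>m\<in>{1..?b}. ?c m) = (\<Sum>m\<in>{1..3}. ?c m) + (\<Sum>m\<in>{4..?b}. ?c m)"
    unfolding ranges(1) by (rule sum.union_disjoint) auto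
  also have "of_nat \<dots> = fps_nth (F * (\<Sum>m\<le>3. ?g m)) N + (\<Sum>m\<in>{4..?b}. fps_nth (F * ?g m) N)"
    unfolding of_nat_add low by (simp only: of_nat_sum high cong: sum.cong)
  also have "\<dots> = fps_nth (F * ((\<Sum>m\<le>3. ?g m) + (\<Sum>m\<in>{4..?b}. ?g m))) N"
    unfolding distrib_left sum_distrib_left fps_add_nth fps_sum_nth ..
  also have "(\<Sum>m\<le>3. ?g m) + (\<Sum>m\<in>{4..?b}. ?g m) = (\<Sum>m\<le>?b. ?g m)"
    unfolding ranges(2) by (rule sum.union_disjoint[symmetric]) auto
  also have "fps_nth (F * (\<Sum>m\<le>?b. ?g m)) N = of_nat (card {mu \<in> partitions_of N.
            (\<forall>x\<in>set mu. x mod 5 = 2 \<or> x mod 5 = 3) \<and>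
            count_list mu 2 = k \<and> count_list mu 3 = j \<and> count_list mu 7 = l})"
    unfolding F_def T_def by (rule parts_2_3_mod_5_gf[symmetric]) simp
  finally show "card {mu \<in> partitions_of N.
            (\<forall>x\<in>set mu. x mod 5 = 2 \<or> x mod 5 = 3) \<and>
            count_list mu 2 = k \<and> count_list mu 3 = j \<and> count_list mu 7 = l} =
     card {lam \<in> partitions_of N. lam \<in> Diff2_star \<and> col_condition k j l (length lam) (col_star lam)}"
    by (simp only: of_nat_eq_iff)
qed

end
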